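(* Let $(X,d,\mathcal{S})$ be a recursively compact computable metric space and let $(K,f)$ be a computable dynamical system in $X$. If $(K,f)$ is expansive, then its topological entropy $h(K,f)$ is a $\Pi_1$-computable number.
   Context: "Algorithm" means Turing machine; countable sets such as $\mathbb{Q}$ are identified with integers via a fixed effective numbering. A computable metric space is a triple $(X,d,\mathcal{S})$ where $(X,d)$ is a metric space and $\mathcal{S}=\{s_i: i\ge 0\}$ is a countable dense subset (its elements are called ideal points) such that some algorithm, on input $(i,j,n)\in\mathbb{N}^3$, outputs $r\in\mathbb{Q}$ with $|d(s_i,s_j)-r|\le 2^{-n}$. Ideal balls are the open balls centered at ideal points with positive rational radii; fix a computable enumeration $(B_n)_{n\in\mathbb{N}}$ of them (center index and radius computable from $n$). For $I\subset\mathbb{N}$, $U_I=\bigcup_{n\in I}B_n$. The space is recursively compact if $(X,d)$ is compact and there is an algorithm which, given a finite $I\subset\mathbb{N}$, halts if and only if $X\subset U_I$. A closed set $K\subset X$ is effective if there is an algorithm such that $X\setminus K=U_I$, where $I$ is the set of integers on which the algorithm halts. A function $f:X\to X$ is computable if there is an algorithm which, given $m$, enumerates a set $I_m\subset\mathbb{N}$ with $f^{-1}(B_m)=U_{I_m}$. A dynamical system in $X$ is a pair $(K,f)$ with $f:X\to X$ continuous and $K\subset X$ (non-empty) compact with $f(K)\subset K$. It is computable if $f$ is computable and $K$ is effective. It is expansive if there exists $\alpha>0$ such that for every pair of distinct points $(x,y)\in X^2$ there exists $n\in\mathbb{N}$ with $d(f^n(x),f^n(y))\ge\alpha$. An open cover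 of $K$ is a collection of open subsets of $X$ whose union contains $K$; a sub-cover is a subcollection which is still a cover of $K$. $N_n(K,f,\mathcal{U})$ is the minimal cardinality of a sub-cover (of $K$) of $\bigvee_{0\le k\le n-1}f^{-k}(\mathcal{U})$, the collection of all intersections $\bigcap_{k=0}^{n-1}f^{-k}(U_k)$ with $U_k\in\mathcal{U}$; $h(K,f,\mathcal{U})=\inf_{n\ge1}\frac{\log_2 N_n(K,f,\mathcal{U})}{n}$, and $h(K,f)=\sup\{h(K,f,\mathcal{U}):\mathcal{U}\text{ finite open cover of }K\}$. A real number is $\Pi_1$-computable (upper-computable) if it is the infimum of a computable sequence of rationals. *)

theory Defs
  imports "HOL-Analysis.Analysis"
begin

section \<open>Turing machines\<close>

text \<open>
  Deterministic machines with finitely many one-way infinite tapes.  States, tape symbols and tapes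
  are initial segments of the natural numbers; the start state is 0, symbol 0 is the blank and
  symbol 1 is the stroke used for unary input and output.  A missing transition means that the
  machine halts.  By \<open>turing_machine\<close>, the transition table is only ever consulted on a finite
  set of arguments, so a machine is a finite object although \<open>delta\<close> is a total function.
\<close>

datatype move = Move_Left | Stay | Move_Right

record machine =
  num_tapes :: nat
  num_states :: nat
  num_symbols :: nat
  delta :: "nat \<Rightarrow> nat list \<Rightarrow> (nat \<times> (nat \<times> move) list) option"

definition turing_machine :: "machine \<Rightarrow> bool" where
  "turing_machine M \<longleftrightarrow>
     1 \<le> num_tapes M \<and> 1 \<le> num_states M \<and> 2 \<le> num_symbols M \<and>
     (\<forall>q xs q' as.
        q < num_states M \<and> length xs = num_tapes M \<and> set xs \<subseteq> {..<num_symbols M} \<and>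
        delta M q xs = Some (q', as) \<longrightarrow>
          q' < num_states M \<and> length as = num_tapes M \<and> fst ` set as \<subseteq> {..<num_symbols M})"

record config =
  state :: nat
  tape :: "nat \<Rightarrow> nat \<Rightarrow> nat"  \<comment> \<open>\<open>tape c i p\<close>: symbol in cell \<open>p\<close> of tape \<open>i\<close>\<close>
  head :: "nat \<Rightarrow> nat"

text \<open>A left move from cell 0 leaves the head where it is.\<close>

fun move_head :: "move \<Rightarrow> nat \<Rightarrow> nat" where
  "move_head Move_Left p = p - 1"
| "move_head Stay p = p"
| "move_head Move_Right p = p + 1"

definition scanned :: "machine \<Rightarrow> config \<Rightarrow> nat list" where
  "scanned M c = map (\<lambda>i. tape c i (head c i)) [0..<num_tapes M]"

definition step :: "machine \<Rightarrow> config \<Rightarrow> config option" where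
  "step M c =
     (case delta M (state c) (scanned M c) of
        None \<Rightarrow> None
      | Some (q', as) \<Rightarrow> Some
          \<lparr> state = q',
            tape = (\<lambda>i. if i < num_tapes M then (tape c i)(head c i := fst (as ! i)) else tape c i),
            head = (\<lambda>i. if i < num_tapes M then move_head (snd (as ! i)) (head c i) else head c i) \<rparr>)"

definition unary :: "nat \<Rightarrow> nat \<Rightarrow> nat" where
  "unary n p = (if p < n then 1 else 0)"

definition init_config :: "nat \<Rightarrow> config" where
  "init_config n = \<lparr> state = 0, tape = (\<lambda>i. if i = 0 then unary n else (\<lambda>_. 0)), head = (\<lambda>_. 0) \<rparr>"

definition halts_with :: "machine \<Rightarrow> nat \<Rightarrow> config \<Rightarrow> bool" where
  "halts_with M n c \<longleftrightarrow>
     (init_config n, c) \<in> {(a, b). step M a = Some b}\<^sup>* \<and> step M c = None"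

definition halts :: "machine \<Rightarrow> nat \<Rightarrow> bool" where
  "halts M n \<longleftrightarrow> (\<exists>c. halts_with M n c)"

definition outputs :: "machine \<Rightarrow> nat \<Rightarrow> nat \<Rightarrow> bool" where
  "outputs M n m \<longleftrightarrow> (\<exists>c. halts_with M n c \<and> tape c 0 = unary m)"


section \<open>Computable functions and sequences\<close>

text \<open>
  Pairs and finite sets of natural numbers are fed to machines through the library's numberings
  \<open>prod_encode\<close> and \<open>set_encode\<close>, and rationals are represented by their \<open>nat_to_rat_surj\<close>-codes.
\<close>

definition computable_fun :: "(nat \<Rightarrow> nat) \<Rightarrow> bool" where
  "computable_fun g \<longleftrightarrow> (\<exists>M. turing_machine M \<and> (\<forall>n. outputs M n (g n)))"

definition computable_rat_seq :: "(nat \<Rightarrow> rat) \<Rightarrow> bool" where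
  "computable_rat_seq q \<longleftrightarrow> (\<exists>g. computable_fun g \<and> (\<forall>n. q n = nat_to_rat_surj (g n)))"

definition Pi1_computable :: "real \<Rightarrow> bool" where
  "Pi1_computable x \<longleftrightarrow>
     (\<exists>q. computable_rat_seq q \<and> bdd_below (range (\<lambda>n. real_of_rat (q n))) \<and>
          x = (INF n. real_of_rat (q n)))"


section \<open>Computable metric spaces\<close>

text \<open>The space is the whole type; \<open>s i\<close> is the \<open>i\<close>-th ideal point.\<close>

definition computable_metric_space :: "(nat \<Rightarrow> 'a::metric_space) \<Rightarrow> bool" where
  "computable_metric_space s \<longleftrightarrow>
     closure (range s) = UNIV \<and>
     (\<exists>q. computable_rat_seq q \<and>
          (\<forall>i j n. \<bar>dist (s i) (s j) - real_of_rat (q (prod_encode (i, prod_encode (j, n))))\<bar>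
                     \<le> 1 / 2 ^ n))"

text \<open>
  \<open>c n\<close> and \<open>r n\<close> are the index of the centre and the radius of the \<open>n\<close>-th ideal ball; every pair
  of an ideal centre and a positive rational radius has to be enumerated.
\<close>

definition ideal_ball_enumeration :: "(nat \<Rightarrow> nat) \<Rightarrow> (nat \<Rightarrow> rat) \<Rightarrow> bool" where
  "ideal_ball_enumeration c r \<longleftrightarrow>
     computable_fun c \<and> computable_rat_seq r \<and> (\<forall>n. r n > 0) \<and>
     (\<forall>i q. q > 0 \<longrightarrow> (\<exists>n. c n = i \<and> r n = q))"

definition ideal_ball ::
    "(nat \<Rightarrow> 'a::metric_space) \<Rightarrow> (nat \<Rightarrow> nat) \<Rightarrow> (nat \<Rightarrow> rat) \<Rightarrow> nat \<Rightarrow> 'a set" where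
  "ideal_ball s c r n = ball (s (c n)) (real_of_rat (r n))"

definition recursively_compact :: "(nat \<Rightarrow> 'a::metric_space set) \<Rightarrow> bool" where
  "recursively_compact B \<longleftrightarrow>
     compact (UNIV :: 'a set) \<and>
     (\<exists>M. turing_machine M \<and>
          (\<forall>I. finite I \<longrightarrow> (halts M (set_encode I) \<longleftrightarrow> UNIV \<subseteq> (\<Union>n\<in>I. B n))))"

definition effective_closed :: "(nat \<Rightarrow> 'a::metric_space set) \<Rightarrow> 'a set \<Rightarrow> bool" where
  "effective_closed B K \<longleftrightarrow>
     closed K \<and> (\<exists>M. turing_machine M \<and> - K = (\<Union>n\<in>{n. halts M n}. B n))"

text \<open>
  An enumeration is a total computable function of a stage \<open>t\<close>, whose value is 0 when nothing is
  listed at that stage and \<open>Suc i\<close> when \<open>i\<close> is listed; so the empty set can be enumerated as well.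
\<close>

definition computable_map :: "(nat \<Rightarrow> 'a::metric_space set) \<Rightarrow> ('a \<Rightarrow> 'a) \<Rightarrow> bool" where
  "computable_map B f \<longleftrightarrow>
     (\<exists>e. computable_fun e \<and>
          (\<forall>m. f -` B m = (\<Union>i\<in>{i. \<exists>t. e (prod_encode (m, t)) = Suc i}. B i)))"


section \<open>Dynamical systems and topological entropy\<close>

definition dynamical_system :: "'a::metric_space set \<Rightarrow> ('a \<Rightarrow> 'a) \<Rightarrow> bool" where
  "dynamical_system K f \<longleftrightarrow>
     continuous_on UNIV f \<and> K \<noteq> {} \<and> compact K \<and> f ` K \<subseteq> K"

definition computable_dynamical_system ::
    "(nat \<Rightarrow> 'a::metric_space set) \<Rightarrow> 'a set \<Rightarrow> ('a \<Rightarrow> 'a) \<Rightarrow> bool" where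
  "computable_dynamical_system B K f \<longleftrightarrow>
     dynamical_system K f \<and> computable_map B f \<and> effective_closed B K"

text \<open>Expansiveness is required of all pairs of points of the space, not just those in \<open>K\<close>.\<close>

definition expansive :: "('a::metric_space \<Rightarrow> 'a) \<Rightarrow> bool" where
  "expansive f \<longleftrightarrow>
     (\<exists>\<alpha>>0. \<forall>x y. x \<noteq> y \<longrightarrow> (\<exists>n. dist ((f ^^ n) x) ((f ^^ n) y) \<ge> \<alpha>))"

definition open_cover :: "'a::topological_space set \<Rightarrow> 'a set set \<Rightarrow> bool" where
  "open_cover K \<U> \<longleftrightarrow> (\<forall>U\<in>\<U>. open U) \<and> K \<subseteq> \<Union>\<U>"

definition cover_join :: "('a \<Rightarrow> 'a) \<Rightarrow> 'a set set \<Rightarrow> nat \<Rightarrow> 'a set set" where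
  "cover_join f \<U> n = {(\<Inter>k<n. (f ^^ k) -` U k) | U. \<forall>k<n. U k \<in> \<U>}"

definition cover_number :: "'a set \<Rightarrow> ('a \<Rightarrow> 'a) \<Rightarrow> 'a set set \<Rightarrow> nat \<Rightarrow> nat" where
  "cover_number K f \<U> n =
     (LEAST m. \<exists>\<C>. \<C> \<subseteq> cover_join f \<U> n \<and> K \<subseteq> \<Union>\<C> \<and> finite \<C> \<and> card \<C> = m)"

definition cover_entropy :: "'a set \<Rightarrow> ('a \<Rightarrow> 'a) \<Rightarrow> 'a set set \<Rightarrow> real" where
  "cover_entropy K f \<U> = (INF n\<in>{1..}. log 2 (real (cover_number K f \<U> n)) / real n)"

definition topological_entropy :: "'a::topological_space set \<Rightarrow> ('a \<Rightarrow> 'a) \<Rightarrow> ereal" where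
  "topological_entropy K f =
     (SUP \<U>\<in>{\<U>. finite \<U> \<and> open_cover K \<U>}. ereal (cover_entropy K f \<U>))"

end

theory Submission
  imports Defs
begin

text \<open>
  Choose \<open>\<alpha>\<close> from expansiveness and a finite cover \<open>\<U>\<close> of the compact space by ideal balls of diameter
  at most \<open>\<alpha> / 2\<close>.  Points whose orbits stay for a long time in the same members of \<open>\<U>\<close> are close
  together, so the joins of \<open>\<U>\<close> eventually refine every open cover of \<open>K\<close>, and the entropy of the system is
  the entropy of this single cover (\<open>entropy_of_generating_cover\<close>), the infimum over \<open>n \<ge> 1\<close> of
  \<open>log 2 (N n) / n\<close>, where \<open>N n\<close> is the cover number of the \<open>n\<close>-th join.  It remains to enumerate the pairs
  \<open>(n, m)\<close> with \<open>N n \<le> m\<close>.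

  Such an inequality has finite certificates.  It says that \<open>m\<close> sets of the form
  \<open>\<Inter>k<n. (f ^^ k) -` B (w l k)\<close>, for \<open>l < m\<close>, cover \<open>K\<close>.  Exchanging union and intersection, this means
  that for every function \<open>\<phi>\<close> from \<open>{..<m}\<close> to \<open>{..<n}\<close> the whole space is covered by the complement of
  \<open>K\<close> and the open sets \<open>(f ^^ \<phi> l) -` B (w l (\<phi> l))\<close>.  All these sets are enumerable unions of ideal
  balls; by compactness a finite stage of the enumeration covers already, and the machine for recursive
  compactness confirms that it does.  A certificate therefore consists of the words \<open>w l\<close> and two step
  bounds (\<open>accepts_sound\<close>, \<open>accepts_complete\<close>).  The required sequence of rationals maps a certificate,
  together with a fraction \<open>p / d \<ge> log 2 m / n\<close>, to this fraction, and everything else to a constant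
  above the entropy.

  Since the step bounds are part of the certificate, checking is primitive recursive, once
  runs of Turing machines can be simulated primitive recursively (\<open>simulation\<close>).  Conversely, a
  Turing machine can compute every primitive recursive function (\<open>pr_computable\<close>), by way of
  structured register programs that are compiled to machines with one unary tape for each register.
\<close>

section \<open>Register programs\<close>

text \<open>
  A structured language for machines whose registers hold natural numbers.  It is small enough to be
  translated into tape operations directly, and its constructs consume what they test: entering the
  second branch of \<open>Case i\<close>, or another round of \<open>Loop i\<close>, decrements register \<open>i\<close>.  On a
  unary tape, testing for zero and decrementing are the same motion of the head.
\<close>

datatype prog = Skip | Inc nat | Seq prog prog | Case nat prog prog | Loop nat prog

type_synonym store = "nat \<Rightarrow> nat"

inductive exec :: "prog \<Rightarrow> store \<Rightarrow> store \<Rightarrow> bool" where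
  Skip: "exec Skip s s"
| Inc: "exec (Inc i) s (s(i := Suc (s i)))"
| Seq: "exec c s s' \<Longrightarrow> exec d s' s'' \<Longrightarrow> exec (Seq c d) s s''"
| CaseZero: "s i = 0 \<Longrightarrow> exec c s s' \<Longrightarrow> exec (Case i c d) s s'"
| CaseSuc: "s i = Suc n \<Longrightarrow> exec d (s(i := n)) s' \<Longrightarrow> exec (Case i c d) s s'"
| LoopZero: "s i = 0 \<Longrightarrow> exec (Loop i c) s s"
| LoopSuc: "s i = Suc n \<Longrightarrow> exec c (s(i := n)) s' \<Longrightarrow> exec (Loop i c) s' s'' \<Longrightarrow> exec (Loop i c) s s''"

text \<open>
  The invariant is given as the family of stores \<open>S n\<close> with \<open>n\<close> rounds to go, so that every loop below
  is verified by writing down this family.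
\<close>

lemma exec_Loop:
  assumes "\<And>n. n < N \<Longrightarrow> exec c ((S (Suc n))(i := n)) (S n)"
    and "\<And>n. n \<le> N \<Longrightarrow> S n i = n"
  shows "exec (Loop i c) (S N) (S 0)"
  using assms
proof (induction N)
  case 0
  then show ?case by (simp add: exec.LoopZero)
next
  case (Suc N)
  have "exec (Loop i c) (S N) (S 0)" by (rule Suc.IH) (use Suc.prems in auto)
  moreover have "exec c ((S (Suc N))(i := N)) (S N)" by (rule Suc.prems(1)) simp
  moreover have "S (Suc N) i = Suc N" by (rule Suc.prems(2)) simp
  ultimately show ?case by (blast intro: exec.LoopSuc)
qed

lemma exec_eq: "exec c s t \<Longrightarrow> t = t' \<Longrightarrow> exec c s t'" by simp

lemma exec_move:
  assumes "a \<noteq> k"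
  shows "exec (Loop a (Inc k)) s (s(a := 0, k := s k + s a))"
proof -
  let ?S = "\<lambda>n. s(a := n, k := s k + (s a - n))"
  have "exec (Loop a (Inc k)) (?S (s a)) (?S 0)"
    by (rule exec_Loop) (use assms in \<open>auto intro!: exec_eq[OF exec.Inc] simp: fun_eq_iff\<close>)
  then show ?thesis using assms by (simp add: fun_upd_idem)
qed

lemma exec_move2:
  assumes "a \<noteq> k" "a \<noteq> l" "k \<noteq> l"
  shows "exec (Loop a (Seq (Inc k) (Inc l))) s (s(a := 0, k := s k + s a, l := s l + s a))"
proof -
  let ?S = "\<lambda>n. s(a := n, k := s k + (s a - n), l := s l + (s a - n))"
  have "exec (Loop a (Seq (Inc k) (Inc l))) (?S (s a)) (?S 0)"
    by (rule exec_Loop)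
      (use assms in \<open>auto intro!: exec_eq[OF exec.Seq[OF exec.Inc exec.Inc]] simp: fun_eq_iff\<close>)
  then show ?thesis using assms by (simp add: fun_upd_idem)
qed

section \<open>Primitive recursive functions as register programs\<close>

text \<open>
  A program for \<open>f\<close> is a template with two parameters: it replaces the content of register \<open>a\<close> by its
  image and may use the registers from \<open>k\<close> on as scratch space, which it finds and leaves empty.
  This makes templates composable, since a caller protects its own data by raising \<open>k\<close>.
\<close>

definition implements :: "(nat \<Rightarrow> nat \<Rightarrow> prog) \<Rightarrow> (nat \<Rightarrow> nat) \<Rightarrow> bool" where
  "implements P f \<longleftrightarrow>
     (\<forall>a k s. a < k \<longrightarrow> (\<forall>j\<ge>k. s j = 0) \<longrightarrow> exec (P a k) s (s(a := f (s a))))"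

lemma implementsD:
  "implements P f \<Longrightarrow> a < k \<Longrightarrow> (\<And>j. j \<ge> k \<Longrightarrow> s j = 0) \<Longrightarrow> exec (P a k) s (s(a := f (s a)))"
  by (auto simp: implements_def)

text \<open>
  The primitive recursive functions in one variable, with several arguments packed by
  \<open>prod_encode\<close>.  Iteration replaces primitive recursion, which is recovered below by carrying the
  arguments and the recursion index along in the iterated value.
\<close>

inductive pr :: "(nat \<Rightarrow> nat) \<Rightarrow> bool" where
  pr_zero: "pr (\<lambda>x. 0)"
| pr_id: "pr (\<lambda>x. x)"
| pr_Suc0: "pr Suc"
| pr_fst0: "pr (\<lambda>x. fst (prod_decode x))"
| pr_snd0: "pr (\<lambda>x. snd (prod_decode x))"
| pr_comp: "pr f \<Longrightarrow> pr g \<Longrightarrow> pr (\<lambda>x. f (g x))"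
| pr_pair: "pr f \<Longrightarrow> pr g \<Longrightarrow> pr (\<lambda>x. prod_encode (f x, g x))"
| pr_funpow0: "pr f \<Longrightarrow> pr (\<lambda>x. (f ^^ snd (prod_decode x)) (fst (prod_decode x)))"

definition decode_prog :: "nat \<Rightarrow> nat \<Rightarrow> prog" where
  "decode_prog a k =
     Seq (Loop a (Inc (k + 1)))
         (Loop (k + 1) (Case k (Seq (Loop a (Inc k)) (Inc k)) (Inc a)))"

text \<open>
  \<open>prod_decode\<close> runs through the pairs diagonal by diagonal.  Hence a pair is decoded by walking along
  the diagonals, one step for each unit of the code.
\<close>

lemma prod_decode_Suc:
  "prod_decode (Suc x) =
     (case prod_decode x of (m, n) \<Rightarrow> if n = 0 then (0, Suc m) else (Suc m, n - 1))"
proof -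
  obtain m n where mn: "prod_decode x = (m, n)" by fastforce
  then have x: "x = prod_encode (m, n)" by (metis prod_decode_inverse)
  have "Suc x = prod_encode (if n = 0 then (0, Suc m) else (Suc m, n - 1))"
    unfolding x by (cases n) (auto simp: prod_encode_def)
  then show ?thesis by (simp add: mn)
qed

lemma exec_decode:
  assumes "a < k" "\<And>j. j \<ge> k \<Longrightarrow> s j = 0"
  shows "exec (decode_prog a k) s
           (s(a := fst (prod_decode (s a)), k := snd (prod_decode (s a))))"
proof -
  let ?D = "\<lambda>n. prod_decode (s a - n)"
  let ?S = "\<lambda>n. s(a := fst (?D n), k := snd (?D n), k + 1 := n)"
  let ?c = "Case k (Seq (Loop a (Inc k)) (Inc k)) (Inc a)"
  have "exec (Loop a (Inc (k + 1))) s (s(a := 0, k + 1 := s a))"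
    by (rule exec_eq[OF exec_move]) (use assms in auto)
  moreover have "exec (Loop (k + 1) ?c) (?S (s a)) (?S 0)"
  proof (rule exec_Loop)
    fix n assume n: "n < s a"
    have D: "?D n = (case ?D (Suc n) of (m, l) \<Rightarrow> if l = 0 then (0, Suc m) else (Suc m, l - 1))"
      using prod_decode_Suc[of "s a - Suc n"] n by (simp add: Suc_diff_Suc)
    obtain m l where ml: "?D (Suc n) = (m, l)" by fastforce
    show "exec ?c ((?S (Suc n))(k + 1 := n)) (?S n)"
    proof (cases l)
      case 0
      show ?thesis
        by (rule exec.CaseZero, (use ml 0 in simp), 
            rule exec_eq[OF exec.Seq[OF exec_move exec.Inc]])
           (use assms in \<open>auto simp: D ml 0 fun_eq_iff\<close>)
    next
      case (Suc l')
      show ?thesis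
        by (rule exec.CaseSuc[of _ _ l'], (use ml Suc in simp), 
            rule exec_eq[OF exec.Inc])
           (use assms in \<open>auto simp: D ml Suc fun_eq_iff\<close>)
    qed
  qed auto
  moreover have "?S (s a) = s(a := 0, k + 1 := s a)"
    using assms by (auto simp: fun_eq_iff prod_decode_def prod_decode_aux.simps)
  moreover have "?S 0 = s(a := fst (prod_decode (s a)), k := snd (prod_decode (s a)))"
    using assms by (auto simp: fun_eq_iff)
  ultimately show ?thesis unfolding decode_prog_def by (metis exec.Seq)
qed

text \<open>
  The code of \<open>(m, n)\<close> is \<open>triangle (m + n) + m\<close>; the middle loop adds the triangular number to the
  copy of \<open>m\<close> in register \<open>k + 1\<close>.
\<close>

definition encode_prog :: "nat \<Rightarrow> nat \<Rightarrow> prog" where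
  "encode_prog a k =
     Seq (Loop a (Seq (Inc (k + 1)) (Inc k)))
    (Seq (Loop k (Seq (Inc (k + 1)) (Seq (Loop k (Seq (Inc (k + 2)) (Inc (k + 1))))
                                         (Loop (k + 2) (Inc k)))))
         (Loop (k + 1) (Inc a)))"

lemma exec_encode:
  assumes "a < k" "\<And>j. j > k \<Longrightarrow> s j = 0"
  shows "exec (encode_prog a k) s (s(a := prod_encode (s a, s k), k := 0))"
proof -
  let ?c = "Seq (Inc (k + 1)) (Seq (Loop k (Seq (Inc (k + 2)) (Inc (k + 1)))) (Loop (k + 2) (Inc k)))"
  let ?N = "s a + s k"
  let ?S = "\<lambda>n. s(a := 0, k := n, k + 1 := s a + (triangle ?N - triangle n))"
  have 1: "exec (Loop a (Seq (Inc (k + 1)) (Inc k))) s (?S ?N)"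
    by (rule exec_eq[OF exec_move2]) (use assms in \<open>auto simp: fun_eq_iff\<close>)
  have "exec (Loop k ?c) (?S ?N) (?S 0)"
  proof (rule exec_Loop)
    fix n assume n: "n < ?N"
    have tri: "triangle (Suc n) \<le> triangle ?N"
    proof -
      have "m \<le> n' \<Longrightarrow> triangle m \<le> triangle n'" for m n'
        by (induction n') (auto simp: le_Suc_eq)
      then show ?thesis using n Suc_leI by blast
    qed
    show "exec ?c ((?S (Suc n))(k := n)) (?S n)"
      by (rule exec_eq[OF exec.Seq[OF exec.Inc exec.Seq[OF exec_move2 exec_move]]])
         (use assms tri in \<open>auto simp: fun_eq_iff\<close>)
  qed (use assms in auto)
  moreover have "exec (Loop (k + 1) (Inc a)) (?S 0) (s(a := prod_encode (s a, s k), k := 0))"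
    by (rule exec_eq[OF exec_move]) (use assms in \<open>auto simp: fun_eq_iff prod_encode_def\<close>)
  ultimately show ?thesis using 1 unfolding encode_prog_def by (meson exec.Seq)
qed

definition copy_prog :: "nat \<Rightarrow> nat \<Rightarrow> prog" where
  "copy_prog a k = Seq (Loop a (Inc (k + 1))) (Loop (k + 1) (Seq (Inc a) (Inc k)))"

lemma exec_copy:
  assumes "a < k" "\<And>j. j \<ge> k \<Longrightarrow> s j = 0"
  shows "exec (copy_prog a k) s (s(k := s a))"
  unfolding copy_prog_def
  by (rule exec_eq[OF exec.Seq[OF exec_move exec_move2]])
     (use assms in \<open>auto simp: fun_eq_iff\<close>)

lemma exec_clear: "exec (Loop k Skip) s (s(k := 0))"
proof -
  have "exec (Loop k Skip) ((\<lambda>n. s(k := n)) (s k)) ((\<lambda>n. s(k := n)) 0)"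
    by (rule exec_Loop) (auto intro!: exec_eq[OF exec.Skip] simp: fun_eq_iff)
  then show ?thesis by simp
qed

lemma pr_implemented:
  assumes "pr f"
  shows "\<exists>P. implements P f"
  using assms
proof induction
  case pr_zero
  have "implements (\<lambda>a k. Loop a Skip) (\<lambda>x. 0)"
    unfolding implements_def using exec_clear by blast
  then show ?case by blast
next
  case pr_id
  have "implements (\<lambda>a k. Skip) (\<lambda>x. x)"
    unfolding implements_def by (simp add: exec.Skip)
  then show ?case by blast
next
  case pr_Suc0
  have "implements (\<lambda>a k. Inc a) Suc"
    unfolding implements_def by (simp add: exec.Inc)
  then show ?case by blast
next
  case pr_fst0
  have "implements (\<lambda>a k. Seq (decode_prog a k) (Loop k Skip)) (\<lambda>x. fst (prod_decode x))"
    unfolding implements_def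
    by (intro allI impI, rule exec_eq[OF exec.Seq[OF exec_decode exec_clear]])
       (auto simp: fun_eq_iff)
  then show ?case by blast
next
  case pr_snd0
  have "implements (\<lambda>a k. Seq (decode_prog a k) (Seq (Loop a Skip) (Loop k (Inc a))))
          (\<lambda>x. snd (prod_decode x))"
    unfolding implements_def
    by (intro allI impI, rule exec_eq[OF exec.Seq[OF exec_decode exec.Seq[OF exec_clear exec_move]]])
       (auto simp: fun_eq_iff)
  then show ?case by blast
next
  case (pr_comp f g)
  then obtain P Q where P: "implements P f" and Q: "implements Q g" by blast
  have "implements (\<lambda>a k. Seq (Q a k) (P a k)) (\<lambda>x. f (g x))"
    unfolding implements_def
    by (intro allI impI, rule exec_eq[OF exec.Seq[OF implementsD[OF Q] implementsD[OF P]]]) auto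
  then show ?case by blast
next
  case (pr_pair f g)
  then obtain P Q where P: "implements P f" and Q: "implements Q g" by blast
  have "implements (\<lambda>a k. Seq (copy_prog a k) (Seq (P a (k + 1)) (Seq (Q k (k + 1)) (encode_prog a k))))
          (\<lambda>x. prod_encode (f x, g x))"
    unfolding implements_def
    by (intro allI impI, rule exec_eq[OF exec.Seq[OF exec_copy exec.Seq[OF implementsD[OF P]
            exec.Seq[OF implementsD[OF Q] exec_encode]]]]) (auto simp: fun_eq_iff)
  then show ?case by blast
next
  case (pr_funpow0 f)
  then obtain P where P: "implements P f" by blast
  have "implements (\<lambda>a k. Seq (decode_prog a k) (Loop k (P a (k + 1))))
          (\<lambda>x. (f ^^ snd (prod_decode x)) (fst (prod_decode x)))"
    unfolding implements_def
  proof (intro allI impI)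
    fix a k :: nat and s :: store
    assume a: "a < k" and s: "\<forall>j\<ge>k. s j = 0"
    obtain u v where uv: "prod_decode (s a) = (u, v)" by fastforce
    let ?S = "\<lambda>n. s(a := (f ^^ (v - n)) u, k := n)"
    have "exec (Loop k (P a (k + 1))) (?S v) (?S 0)"
    proof (rule exec_Loop)
      fix n assume n: "n < v"
      have "f ((f ^^ (v - Suc n)) u) = (f ^^ (v - n)) u"
        using n by (metis Suc_diff_Suc comp_apply funpow.simps(2))
      then show "exec (P a (k + 1)) ((?S (Suc n))(k := n)) (?S n)"
        by (intro exec_eq[OF implementsD[OF P]]) (use a s in \<open>auto simp: fun_eq_iff\<close>)
    qed auto
    moreover have "exec (decode_prog a k) s (?S v)"
      by (rule exec_eq[OF exec_decode]) (use a s uv in \<open>auto\<close>)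
    moreover have "?S 0 = s(a := (f ^^ v) u)"
      using a s by (auto simp: fun_eq_iff)
    ultimately show "exec (Seq (decode_prog a k) (Loop k (P a (k + 1)))) s
        (s(a := (f ^^ snd (prod_decode (s a))) (fst (prod_decode (s a)))))"
      unfolding uv by (metis exec.Seq fst_conv snd_conv)
  qed
  then show ?case by blast
qed

section \<open>Compilation of register programs to Turing machines\<close>

datatype instr = INC nat | DJZ nat nat | JMP nat

fun psize :: "prog \<Rightarrow> nat" where
  "psize Skip = 0"
| "psize (Inc i) = 1"
| "psize (Seq c d) = psize c + psize d"
| "psize (Case i c d) = psize c + psize d + 2"
| "psize (Loop i c) = psize c + 2"

text \<open>
  The jump targets are absolute addresses, so the address \<open>a\<close> of the first instruction is a parameter.
\<close>

fun compile :: "nat \<Rightarrow> prog \<Rightarrow> instr list" where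
  "compile a Skip = []"
| "compile a (Inc i) = [INC i]"
| "compile a (Seq c d) = compile a c @ compile (a + psize c) d"
| "compile a (Case i c d) =
     DJZ i (a + psize d + 2) # compile (a + 1) d @ JMP (a + psize d + 2 + psize c) #
       compile (a + psize d + 2) c"
| "compile a (Loop i c) = DJZ i (a + psize c + 2) # compile (a + 1) c @ [JMP a]"

lemma length_compile [simp]: "length (compile a c) = psize c"
  by (induction c arbitrary: a) auto

fun width :: "prog \<Rightarrow> nat" where
  "width Skip = 1"
| "width (Inc i) = Suc i"
| "width (Seq c d) = max (width c) (width d)"
| "width (Case i c d) = max (Suc i) (max (width c) (width d))"
| "width (Loop i c) = max (Suc i) (width c)"

definition contains_at :: "instr list \<Rightarrow> nat \<Rightarrow> instr list \<Rightarrow> bool" where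
  "contains_at P a Q \<longleftrightarrow> (\<exists>xs ys. P = xs @ Q @ ys \<and> length xs = a)"

lemma contains_at_append:
  "contains_at P a (Q @ Q') \<longleftrightarrow> contains_at P a Q \<and> contains_at P (a + length Q) Q'"
  (is "?L \<longleftrightarrow> ?R")
proof
  assume ?L
  then obtain xs ys where "P = xs @ (Q @ Q') @ ys" "length xs = a" by (auto simp: contains_at_def)
  then show ?R unfolding contains_at_def
    by (metis append_assoc length_append)
next
  assume ?R
  then obtain xs ys where "P = xs @ Q @ ys" "length xs = a" unfolding contains_at_def by blast
  moreover obtain xs' ys' where "P = xs' @ Q' @ ys'" "length xs' = a + length Q"
    using \<open>?R\<close> unfolding contains_at_def by blast
  ultimately have "xs @ Q @ ys = xs' @ Q' @ ys'" "length (xs @ Q) = length xs'" by auto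
  then have "ys = Q' @ ys'" by (metis append.assoc append_eq_append_conv)
  with \<open>P = xs @ Q @ ys\<close> \<open>length xs = a\<close> show ?L unfolding contains_at_def by auto
qed

lemma contains_at_Cons:
  "contains_at P a (i # Q) \<longleftrightarrow> a < length P \<and> P ! a = i \<and> contains_at P (Suc a) Q"
proof -
  have "contains_at P a [i] \<longleftrightarrow> a < length P \<and> P ! a = i"
  proof
    assume "a < length P \<and> P ! a = i"
    then have "P = take a P @ [i] @ drop (Suc a) P" by (metis append_Cons append_Nil id_take_nth_drop)
    then show "contains_at P a [i]" unfolding contains_at_def
      by (metis \<open>a < length P \<and> P ! a = i\<close> length_take min.absorb4)
  qed (auto simp: contains_at_def)
  then show ?thesis using contains_at_append[of P a "[i]" Q] by simp
qed

lemma contains_at_le: "contains_at P a Q \<Longrightarrow> a + length Q \<le> length P"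
  by (auto simp: contains_at_def)

definition act :: "nat list \<Rightarrow> nat \<Rightarrow> nat \<times> move \<Rightarrow> (nat \<times> move) list" where
  "act xs i a = (map (\<lambda>x. (x, Stay)) xs)[i := a]"

definition stay :: "nat list \<Rightarrow> (nat \<times> move) list" where
  "stay xs = map (\<lambda>x. (x, Stay)) xs"

text \<open>
  Register \<open>i\<close> is tape \<open>i\<close>: its content \<open>n\<close> is written in unary and the head rests on the first blank,
  cell \<open>n\<close>.  Then an increment writes a stroke and moves right.  For \<open>DJZ\<close> the head first moves left: it
  now reads a stroke to be erased if \<open>n > 0\<close>, and it is still on the blank cell 0 if \<open>n = 0\<close>, because a
  left move from cell 0 has no effect.

  State 0 moves the head of the input tape to its rest position.  Instruction \<open>pc\<close> starts in
  state \<open>2 * pc + 1\<close>, and state \<open>2 * pc + 2\<close> is the second half of a \<open>DJZ\<close>.  Leaving the program halts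
  the machine.
\<close>

definition register_machine :: "nat \<Rightarrow> instr list \<Rightarrow> machine" where
  "register_machine R P =
     \<lparr> num_tapes = R, num_states = 2 * length P + 3, num_symbols = 2,
       delta = (\<lambda>q xs.
         if q = 0 then
           if xs ! 0 = 1 then Some (0, act xs 0 (1, Move_Right)) else Some (1, stay xs)
         else let pc = (q - 1) div 2 in
           if length P \<le> pc then None
           else (case P ! pc of
               INC i \<Rightarrow> Some (2 * pc + 3, act xs i (1, Move_Right))
             | JMP l \<Rightarrow> Some (2 * min l (length P) + 1, stay xs)
             | DJZ i l \<Rightarrow>
                 if odd q then Some (2 * pc + 2, act xs i (xs ! i, Move_Left))
                 else if xs ! i = 1 then Some (2 * pc + 3, act xs i (0, Stay))
                 else Some (2 * min l (length P) + 1, stay xs))) \<rparr>"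

lemma set_act: "fst ` set (act xs i (w, m)) \<subseteq> insert w (set xs)"
proof
  fix x assume "x \<in> fst ` set (act xs i (w, m))"
  then obtain y where "y \<in> set (act xs i (w, m))" "x = fst y" by blast
  then show "x \<in> insert w (set xs)"
    unfolding act_def using set_update_subset_insert[of "map (\<lambda>x. (x, Stay)) xs" i "(w, m)"] by auto
qed

lemma act_in_range:
  "set xs \<subseteq> {..<2} \<Longrightarrow> w < 2 \<Longrightarrow> fst ` set (act xs i (w, m)) \<subseteq> {..<2}"
  using set_act[of xs i w m] by auto

lemma length_act [simp]: "length (act xs i a) = length xs" by (simp add: act_def)
lemma length_stay [simp]: "length (stay xs) = length xs" by (simp add: stay_def)

lemma turing_machine_register_machine:
  assumes "1 \<le> R"
  shows "turing_machine (register_machine R P)"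
  unfolding turing_machine_def
proof (intro conjI allI impI)
  fix q xs q' as
  assume *: "q < num_states (register_machine R P) \<and> length xs = num_tapes (register_machine R P) \<and>
     set xs \<subseteq> {..<num_symbols (register_machine R P)} \<and>
     delta (register_machine R P) q xs = Some (q', as)"
  then have xs: "set xs \<subseteq> {..<2}" "length xs = R" and d: "delta (register_machine R P) q xs = Some (q', as)"
    by (auto simp: register_machine_def)
  have nth: "xs ! i < 2" if "i < R" for i using xs that nth_mem by fastforce
  have act2: "fst ` set (act xs i (xs ! i, m)) \<subseteq> {..<2}" for i m
  proof (cases "i < R")
    case True then show ?thesis using act_in_range[OF xs(1) nth] by blast
  next
    case False then show ?thesis using xs by (auto simp: act_def list_update_beyond)
  qed
  have entries: "a < 2" if "(a, b) \<in> set (act xs i (w, m))" "w < 2 \<or> w = xs ! i" for a b i w m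
    using that act_in_range[OF xs(1), of w i m] act2[of i m] by force
  have "q' < 2 * length P + 3 \<and> length as = length xs \<and> fst ` set as \<subseteq> {..<2}"
    using d xs
    by (auto simp: register_machine_def Let_def stay_def split: if_splits instr.splits dest: entries)
  then show "q' < num_states (register_machine R P)" "length as = num_tapes (register_machine R P)"
      "fst ` set as \<subseteq> {..<num_symbols (register_machine R P)}"
    using xs by (auto simp: register_machine_def)
qed (use assms in \<open>auto simp: register_machine_def\<close>)

definition store_config :: "nat \<Rightarrow> store \<Rightarrow> config" where
  "store_config q s = \<lparr> state = q, tape = (\<lambda>i. unary (s i)), head = s \<rparr>"

abbreviation moves :: "machine \<Rightarrow> (config \<times> config) set" where
  "moves M \<equiv> {(a, b). step M a = Some b}"

lemma two_steps: "step M a = Some b \<Longrightarrow> step M b = Some c \<Longrightarrow> (a, c) \<in> (moves M)\<^sup>*"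
  by (rule rtrancl_trans[of _ b]) auto

lemma steps_snoc:
  "(a, b) \<in> (moves M)\<^sup>* \<Longrightarrow> step M b = Some c \<Longrightarrow> (a, c) \<in> (moves M)\<^sup>*"
  by (rule rtrancl_trans[of _ b]) auto

context
  fixes R :: nat and P :: "instr list" and M :: machine
  defines "M \<equiv> register_machine R P"
begin

lemma num_tapes_M [simp]: "num_tapes M = R" by (simp add: M_def register_machine_def)

lemma scanned_nth: "i < R \<Longrightarrow> scanned M c ! i = tape c i (head c i)"
  by (simp add: scanned_def)

lemma length_scanned [simp]: "length (scanned M c) = R"
  by (simp add: scanned_def)

lemma step_stay:
  assumes "delta M (state c) (scanned M c) = Some (q, stay (scanned M c))"
  shows "step M c = Some (c\<lparr>state := q\<rparr>)"
proof -
  have "(\<lambda>i. if i < R then (tape c i)(head c i := fst (stay (scanned M c) ! i)) else tape c i) = tape c"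
    "(\<lambda>i. if i < R then move_head (snd (stay (scanned M c) ! i)) (head c i) else head c i) = head c"
    by (auto simp: stay_def scanned_nth fun_eq_iff)
  then show ?thesis by (simp add: step_def assms)
qed

lemma step_act:
  assumes "delta M (state c) (scanned M c) = Some (q, act (scanned M c) i (w, m))" "i < R"
  shows "step M c = Some
    \<lparr> state = q, tape = (tape c)(i := (tape c i)(head c i := w)),
      head = (head c)(i := move_head m (head c i)) \<rparr>"
proof -
  have "(\<lambda>j. if j < R then (tape c j)(head c j := fst (act (scanned M c) i (w, m) ! j)) else tape c j) =
      (tape c)(i := (tape c i)(head c i := w))"
    "(\<lambda>j. if j < R then move_head (snd (act (scanned M c) i (w, m) ! j)) (head c j) else head c j) =
      (head c)(i := move_head m (head c i))"
    using assms(2) by (auto simp: act_def scanned_nth fun_eq_iff nth_list_update)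
  then show ?thesis by (simp add: step_def assms(1))
qed

lemma scanned_store [simp]: "i < R \<Longrightarrow> scanned M (store_config q s) ! i = 0"
  by (simp add: scanned_nth store_config_def unary_def)

lemma step_INC:
  assumes "pc < length P" "P ! pc = INC i" "i < R"
  shows "step M (store_config (2 * pc + 1) s) = Some (store_config (2 * (pc + 1) + 1) (s(i := Suc (s i))))"
proof -
  let ?c = "store_config (2 * pc + 1) s"
  have "delta M (state ?c) (scanned M ?c) = Some (2 * pc + 3, act (scanned M ?c) i (1, Move_Right))"
    using assms by (simp add: M_def register_machine_def store_config_def)
  from step_act[OF this assms(3)] show ?thesis
    by (auto simp: store_config_def fun_eq_iff unary_def)
qed

lemma step_JMP:
  assumes "pc < length P" "P ! pc = JMP l" "l \<le> length P"
  shows "step M (store_config (2 * pc + 1) s) = Some (store_config (2 * l + 1) s)"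
proof -
  let ?c = "store_config (2 * pc + 1) s"
  have "delta M (state ?c) (scanned M ?c) = Some (2 * l + 1, stay (scanned M ?c))"
    using assms by (simp add: M_def register_machine_def store_config_def)
  from step_stay[OF this] show ?thesis by (simp add: store_config_def)
qed

lemma steps_DJZ:
  assumes "pc < length P" "P ! pc = DJZ i l" "l \<le> length P" "i < R"
  shows "s i = 0 \<Longrightarrow> (store_config (2 * pc + 1) s, store_config (2 * l + 1) s) \<in> (moves M)\<^sup>*"
    and "s i = Suc n \<Longrightarrow>
      (store_config (2 * pc + 1) s, store_config (2 * (pc + 1) + 1) (s(i := n))) \<in> (moves M)\<^sup>*"
proof -
  let ?c = "store_config (2 * pc + 1) s"
  have "delta M (state ?c) (scanned M ?c) =
      Some (2 * pc + 2, act (scanned M ?c) i (scanned M ?c ! i, Move_Left))"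
    using assms by (simp add: M_def register_machine_def store_config_def)
  from step_act[OF this assms(4)]
  have 1: "step M ?c = Some \<lparr>state = 2 * pc + 2, tape = (\<lambda>i. unary (s i)), head = s(i := s i - 1)\<rparr>"
    (is "_ = Some ?c'")
    using assms(4)
    by (auto simp: fun_eq_iff scanned_nth) (auto simp: store_config_def unary_def)
  have d: "delta M (state ?c') (scanned M ?c') =
      (if scanned M ?c' ! i = 1 then Some (2 * pc + 3, act (scanned M ?c') i (0, Stay))
       else Some (2 * l + 1, stay (scanned M ?c')))"
    using assms by (simp add: M_def register_machine_def)
  show "(?c, store_config (2 * l + 1) s) \<in> (moves M)\<^sup>*" if "s i = 0"
  proof -
    have "scanned M ?c' ! i = 0" using that assms by (simp add: scanned_nth unary_def)
    with d have "delta M (state ?c') (scanned M ?c') = Some (2 * l + 1, stay (scanned M ?c'))" by simp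
    from step_stay[OF this] have "step M ?c' = Some (store_config (2 * l + 1) s)"
      using that by (simp add: store_config_def fun_upd_idem)
    with 1 show ?thesis by (rule two_steps)
  qed
  show "(?c, store_config (2 * (pc + 1) + 1) (s(i := n))) \<in> (moves M)\<^sup>*" if "s i = Suc n"
  proof -
    have "scanned M ?c' ! i = 1" using that assms by (simp add: scanned_nth unary_def)
    with d have "delta M (state ?c') (scanned M ?c') = Some (2 * pc + 3, act (scanned M ?c') i (0, Stay))" by simp
    from step_act[OF this assms(4)] have "step M ?c' = Some (store_config (2 * (pc + 1) + 1) (s(i := n)))"
      using that by (auto simp: store_config_def fun_eq_iff unary_def)
    with 1 show ?thesis by (rule two_steps)
  qed
qed

text \<open>
  One direction suffices: the machine is deterministic, so an execution of the program already
  determines what the machine does.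
\<close>

lemma compile_correct:
  assumes "exec c s s'" "contains_at P a (compile a c)" "width c \<le> R"
  shows "(store_config (2 * a + 1) s, store_config (2 * (a + psize c) + 1) s') \<in> (moves M)\<^sup>*"
  using assms
proof (induction arbitrary: a)
  case (Skip s)
  then show ?case by simp
next
  case (Inc i s)
  then have "step M (store_config (2 * a + 1) s) = Some (store_config (2 * (a + 1) + 1) (s(i := Suc (s i))))"
    by (intro step_INC) (auto simp: contains_at_Cons)
  then show ?case by (simp add: r_into_rtrancl del: fun_upd_apply)
next
  case (Seq c s s' d s'')
  have 1: "(store_config (2 * a + 1) s, store_config (2 * (a + psize c) + 1) s') \<in> (moves M)\<^sup>*"
    by (rule Seq.IH(1)) (use Seq.prems in \<open>auto simp: contains_at_append\<close>)
  have 2: "(store_config (2 * (a + psize c) + 1) s', store_config (2 * (a + psize c + psize d) + 1) s'') \<in> (moves M)\<^sup>*"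
    by (rule Seq.IH(2)) (use Seq.prems in \<open>auto simp: contains_at_append\<close>)
  show ?case using rtrancl_trans[OF 1 2] by (simp add: add.assoc)
next
  case (CaseZero s i c s' d)
  have le: "a + psize d + 2 + psize c \<le> length P"
    using contains_at_le[OF CaseZero.prems(1)] by simp
  have 1: "(store_config (2 * a + 1) s, store_config (2 * (a + psize d + 2) + 1) s) \<in> (moves M)\<^sup>*"
    by (rule steps_DJZ(1)) (use CaseZero le in \<open>auto simp: contains_at_Cons contains_at_append\<close>)
  have 2: "(store_config (2 * (a + psize d + 2) + 1) s,
      store_config (2 * (a + psize d + 2 + psize c) + 1) s') \<in> (moves M)\<^sup>*"
    by (rule CaseZero.IH) (use CaseZero in \<open>auto simp: contains_at_Cons contains_at_append\<close>)
  show ?case using rtrancl_trans[OF 1 2] by (simp add: algebra_simps)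
next
  case (CaseSuc s i n d s' c)
  have le: "a + psize d + 2 + psize c \<le> length P"
    using contains_at_le[OF CaseSuc.prems(1)] by simp
  have 1: "(store_config (2 * a + 1) s, store_config (2 * (a + 1) + 1) (s(i := n))) \<in> (moves M)\<^sup>*"
    by (rule steps_DJZ(2)[where l = "a + psize d + 2"]) (use CaseSuc le in \<open>auto simp: contains_at_Cons contains_at_append\<close>)
  have 2: "(store_config (2 * (a + 1) + 1) (s(i := n)),
      store_config (2 * (a + 1 + psize d) + 1) s') \<in> (moves M)\<^sup>*"
    by (rule CaseSuc.IH) (use CaseSuc in \<open>auto simp: contains_at_Cons contains_at_append\<close>)
  have 3: "step M (store_config (2 * (a + 1 + psize d) + 1) s') =
      Some (store_config (2 * (a + psize d + 2 + psize c) + 1) s')"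
    by (rule step_JMP) (use CaseSuc le in \<open>auto simp: contains_at_Cons contains_at_append\<close>)
  have "(store_config (2 * a + 1) s, store_config (2 * (a + psize d + 2 + psize c) + 1) s') \<in> (moves M)\<^sup>*"
    by (rule steps_snoc[OF rtrancl_trans[OF 1 2] 3])
  then show ?case by (simp add: algebra_simps)
next
  case (LoopZero s i c)
  have le: "a + psize c + 2 \<le> length P"
    using contains_at_le[OF LoopZero.prems(1)] by simp
  have "(store_config (2 * a + 1) s, store_config (2 * (a + psize c + 2) + 1) s) \<in> (moves M)\<^sup>*"
    by (rule steps_DJZ(1)) (use LoopZero le in \<open>auto simp: contains_at_Cons contains_at_append\<close>)
  then show ?case by (simp add: algebra_simps)
next
  case (LoopSuc s i n c s' s'')
  have le: "a + psize c + 2 \<le> length P"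
    using contains_at_le[OF LoopSuc.prems(1)] by simp
  have 1: "(store_config (2 * a + 1) s, store_config (2 * (a + 1) + 1) (s(i := n))) \<in> (moves M)\<^sup>*"
    by (rule steps_DJZ(2)[where l = "a + psize c + 2"]) (use LoopSuc le in \<open>auto simp: contains_at_Cons contains_at_append\<close>)
  have 2: "(store_config (2 * (a + 1) + 1) (s(i := n)),
      store_config (2 * (a + 1 + psize c) + 1) s') \<in> (moves M)\<^sup>*"
    by (rule LoopSuc.IH(1)) (use LoopSuc in \<open>auto simp: contains_at_Cons contains_at_append\<close>)
  have 3: "step M (store_config (2 * (a + 1 + psize c) + 1) s') = Some (store_config (2 * a + 1) s')"
    by (rule step_JMP) (use LoopSuc le in \<open>auto simp: contains_at_Cons contains_at_append\<close>)
  have 4: "(store_config (2 * a + 1) s', store_config (2 * (a + psize (Loop i c)) + 1) s'') \<in> (moves M)\<^sup>*"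
    by (rule LoopSuc.IH(2)) (use LoopSuc in auto)
  have "(store_config (2 * a + 1) s, store_config (2 * a + 1) s') \<in> (moves M)\<^sup>*"
    by (rule steps_snoc[OF rtrancl_trans[OF 1 2] 3])
  then show ?case using 4 by (rule rtrancl_trans)
qed

lemma initial_walk:
  assumes "1 \<le> R" "k \<le> n"
  shows "(init_config n, \<lparr> state = 0, tape = (\<lambda>i. if i = 0 then unary n else (\<lambda>_. 0)),
    head = (\<lambda>i. if i = 0 then k else 0) \<rparr>) \<in> (moves M)\<^sup>*"
  using assms(2)
proof (induction k)
  case 0
  then show ?case by (simp add: init_config_def)
next
  case (Suc k)
  let ?c = "\<lparr> state = 0, tape = (\<lambda>i. if i = 0 then unary n else (\<lambda>_. 0)),
    head = (\<lambda>i. if i = 0 then k else 0) \<rparr>"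
  have "delta M (state ?c) (scanned M ?c) = Some (0, act (scanned M ?c) 0 (1, Move_Right))"
    using scanned_nth[of 0 ?c] assms Suc.prems by (simp add: M_def register_machine_def unary_def)
  from step_act[OF this] assms(1)
  have "step M ?c = Some \<lparr> state = 0, tape = (\<lambda>i. if i = 0 then unary n else (\<lambda>_. 0)),
    head = (\<lambda>i. if i = 0 then Suc k else 0) \<rparr>"
    using Suc.prems by (auto simp: fun_eq_iff unary_def)
  then show ?case using Suc by (auto intro: steps_snoc)
qed

lemma initial_steps:
  assumes "1 \<le> R"
  shows "(init_config n, store_config 1 (\<lambda>i. if i = 0 then n else 0)) \<in> (moves M)\<^sup>*"
proof -
  let ?c = "\<lparr> state = 0, tape = (\<lambda>i. if i = 0 then unary n else (\<lambda>_. 0)),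
    head = (\<lambda>i. if i = 0 then n else 0) \<rparr>"
  have "delta M (state ?c) (scanned M ?c) = Some (1, stay (scanned M ?c))"
    using scanned_nth[of 0 ?c] assms by (simp add: M_def register_machine_def unary_def)
  from step_stay[OF this]
  have "step M ?c = Some (store_config 1 (\<lambda>i. if i = 0 then n else 0))"
    by (auto simp: store_config_def fun_eq_iff unary_def)
  with initial_walk[OF assms order.refl] show ?thesis by (rule steps_snoc)
qed

end

text \<open>
  This reduces the computability of a function to writing it in terms of primitive recursive
  operations.  Unbounded search never occurs: in the enumeration of upper bounds for the entropy,
  the number of steps that are granted to a computation is part of the input.
\<close>

theorem pr_computable:
  assumes "pr f"
  shows "computable_fun f"
proof -
  obtain Q where Q: "implements Q f" using pr_implemented[OF assms] by blast
  define c where "c = Q 0 1"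
  define R where "R = width c"
  define P where "P = compile 0 c"
  define M where "M = register_machine R P"
  have R: "1 \<le> R" unfolding R_def by (induction c) auto
  have "outputs M n (f n)" for n
  proof -
    let ?s = "\<lambda>i. if i = 0 then n else 0 :: nat"
    have "exec c ?s (?s(0 := f n))"
      unfolding c_def by (rule exec_eq[OF implementsD[OF Q]]) auto
    then have "(store_config (2 * 0 + 1) ?s, store_config (2 * (0 + psize c) + 1) (?s(0 := f n))) \<in> (moves M)\<^sup>*"
      unfolding M_def by (rule compile_correct) (auto simp: P_def R_def contains_at_def)
    with initial_steps[OF R, of n P]
    have "(init_config n, store_config (2 * psize c + 1) (?s(0 := f n))) \<in> (moves M)\<^sup>*"
      unfolding M_def by simp
    moreover have "step M (store_config (2 * psize c + 1) (?s(0 := f n))) = None"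
      by (simp add: step_def M_def register_machine_def store_config_def P_def)
    ultimately show ?thesis unfolding outputs_def halts_with_def
      by (intro exI[of _ "store_config (2 * psize c + 1) (?s(0 := f n))"])
         (simp add: store_config_def)
  qed
  then show ?thesis unfolding computable_fun_def M_def using turing_machine_register_machine[OF R] by blast
qed

section \<open>Closure properties of primitive recursive functions\<close>

abbreviation pfst :: "nat \<Rightarrow> nat" where "pfst z \<equiv> fst (prod_decode z)"
abbreviation psnd :: "nat \<Rightarrow> nat" where "psnd z \<equiv> snd (prod_decode z)"

text \<open>
  Closure rules are stated for the values of functions at a common argument \<open>x\<close>, so that the
  introduction rules can follow the structure of a term.  A binder moves \<open>x\<close> and the bound variable
  into the two components of a new argument.
\<close>

named_theorems pr_intros

declare pr_id [pr_intros]

lemma pr_const [pr_intros]: "pr (\<lambda>x. c)"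
proof (induction c)
  case (Suc c)
  show ?case using pr_comp[OF pr_Suc0 Suc] by simp
qed (rule pr_zero)

lemma pr_Suc [pr_intros]: "pr f \<Longrightarrow> pr (\<lambda>x. Suc (f x))"
  using pr_comp[OF pr_Suc0] .

lemma pr_pfst [pr_intros]: "pr f \<Longrightarrow> pr (\<lambda>x. pfst (f x))"
  using pr_comp[OF pr_fst0] .

lemma pr_psnd [pr_intros]: "pr f \<Longrightarrow> pr (\<lambda>x. psnd (f x))"
  using pr_comp[OF pr_snd0] .

declare pr_pair [pr_intros]

lemma pr_funpow:
  assumes f: "pr f" and a: "pr a" and n: "pr n"
  shows "pr (\<lambda>x. (f ^^ n x) (a x))"
  using pr_comp[OF pr_funpow0[OF f] pr_pair[OF a n]] by simp

lemma pr_rec [pr_intros]: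
  assumes a: "pr a" and h: "pr (\<lambda>z. H (pfst z) (pfst (psnd z)) (psnd (psnd z)))" and n: "pr n"
  shows "pr (\<lambda>x. rec_nat (a x) (H x) (n x))"
proof -
  let ?f = "\<lambda>z. prod_encode (pfst z, prod_encode (Suc (pfst (psnd z)),
              H (pfst z) (pfst (psnd z)) (psnd (psnd z))))"
  have f: "pr ?f" by (intro pr_intros h)
  have "(?f ^^ m) (prod_encode (x, prod_encode (0, a x))) =
      prod_encode (x, prod_encode (m, rec_nat (a x) (H x) m))" for m x
    by (induction m) simp_all
  then have "(\<lambda>x. rec_nat (a x) (H x) (n x)) =
      (\<lambda>x. psnd (psnd ((?f ^^ n x) (prod_encode (x, prod_encode (0, a x))))))"
    by simp
  moreover have "pr \<dots>" by (intro pr_intros pr_funpow[OF f] a n)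
  ultimately show ?thesis by simp
qed

lemma pr_add [pr_intros]:
  assumes "pr f" "pr g" shows "pr (\<lambda>x. f x + g x)"
proof -
  have "rec_nat k (\<lambda>_ v. Suc v) m = k + m" for k m by (induction m) auto
  moreover have "pr (\<lambda>x. rec_nat (f x) (\<lambda>_ v. Suc v) (g x))" by (intro pr_intros assms)
  ultimately show ?thesis by simp
qed

lemma pr_mult [pr_intros]:
  assumes "pr f" "pr g" shows "pr (\<lambda>x. f x * g x)"
proof -
  have "rec_nat 0 (\<lambda>_ v. v + k) m = k * m" for k m :: nat by (induction m) auto
  moreover have "pr (\<lambda>x. rec_nat 0 (\<lambda>_ v. v + f x) (g x))" by (intro pr_intros assms pr_comp[OF assms(1)])
  ultimately show ?thesis by simp
qed

lemma pr_power [pr_intros]: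
  assumes "pr f" "pr g" shows "pr (\<lambda>x. f x ^ g x)"
proof -
  have "rec_nat 1 (\<lambda>_ v. v * k) m = k ^ m" for k m :: nat by (induction m) auto
  moreover have "pr (\<lambda>x. rec_nat 1 (\<lambda>_ v. v * f x) (g x))" by (intro pr_intros assms pr_comp[OF assms(1)])
  ultimately show ?thesis by simp
qed

lemma pr_diff [pr_intros]:
  assumes "pr f" "pr g" shows "pr (\<lambda>x. f x - g x)"
proof -
  have pred: "rec_nat 0 (\<lambda>i _. i) m = m - 1" for m :: nat by (cases m) auto
  have pr_pred: "pr (\<lambda>x. rec_nat 0 (\<lambda>i _. i) x)" by (intro pr_intros)
  have "rec_nat k (\<lambda>_ v. rec_nat 0 (\<lambda>i _. i) v) m = k - m" for k m :: nat
    by (induction m) (auto simp: pred)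
  moreover have "pr (\<lambda>x. rec_nat (f x) (\<lambda>_ v. rec_nat 0 (\<lambda>i _. i) v) (g x))"
    by (intro pr_intros assms)
  ultimately show ?thesis by simp
qed

definition pr_pred :: "(nat \<Rightarrow> bool) \<Rightarrow> bool" where
  "pr_pred P \<longleftrightarrow> pr (\<lambda>x. of_bool (P x))"

lemma pr_of_bool [pr_intros]: "pr_pred P \<Longrightarrow> pr (\<lambda>x. of_bool (P x))"
  by (simp add: pr_pred_def)

lemma pr_if [pr_intros]:
  assumes "pr_pred P" "pr f" "pr g" shows "pr (\<lambda>x. if P x then f x else g x)"
proof -
  have "(\<lambda>x. if P x then f x else g x) = (\<lambda>x. of_bool (P x) * f x + (1 - of_bool (P x)) * g x)"
    by auto
  then show ?thesis using assms by (auto intro!: pr_intros)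
qed

lemma pr_pred_le [pr_intros]:
  assumes "pr f" "pr g" shows "pr_pred (\<lambda>x. f x \<le> g x)"
proof -
  have "(\<lambda>x. of_bool (f x \<le> g x)) = (\<lambda>x. 1 - (f x - g x))" by (auto simp: fun_eq_iff)
  then show ?thesis using assms by (auto simp: pr_pred_def intro!: pr_intros)
qed

lemma pr_pred_not [pr_intros]:
  assumes "pr_pred P" shows "pr_pred (\<lambda>x. \<not> P x)"
proof -
  have "(\<lambda>x. of_bool (\<not> P x)) = (\<lambda>x. 1 - of_bool (P x) :: nat)" by (auto simp: fun_eq_iff)
  then show ?thesis using assms by (auto simp: pr_pred_def intro!: pr_intros)
qed

lemma pr_pred_conj [pr_intros]:
  assumes "pr_pred P" "pr_pred Q" shows "pr_pred (\<lambda>x. P x \<and> Q x)"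
proof -
  have "(\<lambda>x. of_bool (P x \<and> Q x)) = (\<lambda>x. of_bool (P x) * of_bool (Q x) :: nat)" by (auto simp: fun_eq_iff)
  then show ?thesis using assms by (auto simp: pr_pred_def intro!: pr_intros)
qed

lemma pr_pred_disj [pr_intros]:
  assumes "pr_pred P" "pr_pred Q" shows "pr_pred (\<lambda>x. P x \<or> Q x)"
  using pr_pred_not[OF pr_pred_conj[OF pr_pred_not[OF assms(1)] pr_pred_not[OF assms(2)]]] by simp

lemma pr_pred_eq [pr_intros]:
  assumes "pr f" "pr g" shows "pr_pred (\<lambda>x. f x = g x)"
  using pr_pred_conj[OF pr_pred_le[OF assms] pr_pred_le[OF assms(2,1)]] by (simp add: order.eq_iff)

lemma pr_pred_less [pr_intros]:
  assumes "pr f" "pr g" shows "pr_pred (\<lambda>x. f x < g x)"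
  using pr_pred_not[OF pr_pred_le[OF assms(2,1)]] by (simp add: not_le)

lemma pr_sum [pr_intros]:
  assumes "pr (\<lambda>z. F (pfst z) (psnd z))" "pr b"
  shows "pr (\<lambda>x. \<Sum>i<b x. F x i)"
proof -
  have "rec_nat 0 (\<lambda>i v. v + F x i) m = (\<Sum>i<m. F x i)" for x m by (induction m) auto
  moreover have "pr (\<lambda>x. rec_nat 0 (\<lambda>i v. v + F x i) (b x))"
  proof (intro pr_intros assms)
    show "pr (\<lambda>z. F (pfst z) (pfst (psnd z)))"
      using pr_comp[OF assms(1), of "\<lambda>z. prod_encode (pfst z, pfst (psnd z))"]
      by (simp add: pr_intros)
  qed
  ultimately show ?thesis by simp
qed

lemma pr_pred_all [pr_intros]:
  assumes "pr_pred (\<lambda>z. P (pfst z) (psnd z))" "pr b"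
  shows "pr_pred (\<lambda>x. \<forall>i<b x. P x i)"
proof -
  have "(\<lambda>x. (\<Sum>i<b x. of_bool (\<not> P x i)) = (0 :: nat)) = (\<lambda>x. \<forall>i<b x. P x i)"
    by (auto simp: fun_eq_iff)
  moreover have "pr_pred (\<lambda>x. (\<Sum>i<b x. of_bool (\<not> P x i)) = (0 :: nat))"
    by (intro pr_intros assms)
  ultimately show ?thesis by simp
qed

lemma pr_pred_ex [pr_intros]:
  assumes "pr_pred (\<lambda>z. P (pfst z) (psnd z))" "pr b"
  shows "pr_pred (\<lambda>x. \<exists>i<b x. P x i)"
  using pr_pred_not[OF pr_pred_all[OF pr_pred_not[OF assms(1)] assms(2)]] by simp

text \<open>
  The quotient counts the multiples of the divisor; the guard \<open>0 < n\<close> is the convention \<open>m div 0 = 0\<close>.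
\<close>

lemma pr_div [pr_intros]:
  assumes "pr f" "pr g" shows "pr (\<lambda>x. f x div g x)"
proof -
  have "(\<Sum>i<m. of_bool (0 < n \<and> Suc i * n \<le> m)) = m div n" for m n :: nat
  proof (cases "n = 0")
    case False
    have "{i. i < m \<and> Suc i * n \<le> m} = {..<m div n}"
    proof (intro set_eqI iffI)
      fix i assume "i \<in> {i. i < m \<and> Suc i * n \<le> m}"
      then show "i \<in> {..<m div n}" using False by (simp add: less_eq_div_iff_mult_less_eq Suc_le_eq[symmetric])
    next
      fix i assume "i \<in> {..<m div n}"
      then have "Suc i \<le> m div n" by simp
      then have "Suc i * n \<le> m" using False by (simp add: less_eq_div_iff_mult_less_eq)
      moreover have "Suc i \<le> m" using \<open>Suc i \<le> m div n\<close> div_le_dividend le_trans by blast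
      ultimately show "i \<in> {i. i < m \<and> Suc i * n \<le> m}" by simp
    qed
    moreover have "(\<Sum>i<m. of_bool (0 < n \<and> Suc i * n \<le> m)) = card {i. i < m \<and> Suc i * n \<le> m}"
      using False by (simp add: sum_of_bool_eq Int_def)
    ultimately show ?thesis by simp
  qed simp
  moreover have "pr (\<lambda>x. \<Sum>i<f x. of_bool (0 < g x \<and> Suc i * g x \<le> f x))"
    by (intro pr_intros assms pr_comp[OF assms(1)] pr_comp[OF assms(2)])
  ultimately show ?thesis by simp
qed

lemma pr_mod [pr_intros]:
  assumes "pr f" "pr g" shows "pr (\<lambda>x. f x mod g x)"
  using pr_diff[OF assms(1) pr_mult[OF assms(2) pr_div[OF assms]]]
  by (simp add: minus_mult_div_eq_mod)

text \<open>
  Constants that depend on no algorithm, such as a transition table or a finite choice of balls, enter a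
  computation in this way.
\<close>

lemma pr_finite_table:
  assumes "finite A" shows "\<exists>h. pr h \<and> (\<forall>x\<in>A. h x = (g x :: nat))"
  using assms
proof induction
  case empty
  then show ?case using pr_zero by blast
next
  case (insert a A)
  then obtain h where "pr h" "\<forall>x\<in>A. h x = g x" by blast
  then have "pr (\<lambda>x. if x = a then g a else h x)" "\<forall>x\<in>insert a A. (if x = a then g a else h x) = g x"
    by (auto intro!: pr_intros)
  then show ?case by blast
qed

section \<open>Primitive recursive simulation of Turing machines\<close>

fun tuple :: "nat list \<Rightarrow> nat" where
  "tuple [] = 0"
| "tuple (x # xs) = prod_encode (x, tuple xs)"

definition entry :: "nat \<Rightarrow> nat \<Rightarrow> nat" where
  "entry i z = pfst ((psnd ^^ i) z)"

lemma entry_tuple [simp]: "i < length xs \<Longrightarrow> entry i (tuple xs) = xs ! i"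
proof (induction xs arbitrary: i)
  case (Cons x xs)
  then show ?case by (cases i) (auto simp: entry_def funpow_Suc_right simp del: funpow.simps)
qed simp

lemma pr_entry [pr_intros]: "pr f \<Longrightarrow> pr (\<lambda>x. entry i (f x))"
  unfolding entry_def by (intro pr_intros pr_funpow)

lemma pr_tuple:
  assumes "\<And>i. i \<in> set is \<Longrightarrow> pr (F i)"
  shows "pr (\<lambda>x. tuple (map (\<lambda>i. F i x) is))"
  using assms by (induction "is") (auto intro!: pr_intros)

text \<open>
  A tape with symbols below \<open>b\<close> and only finitely many non-blank cells is the number whose base \<open>b\<close> digits
  are its cells.
\<close>

definition digit :: "nat \<Rightarrow> nat \<Rightarrow> nat \<Rightarrow> nat" where
  "digit b p T = T div b ^ p mod b"

lemma pr_digit [pr_intros]: "pr b \<Longrightarrow> pr p \<Longrightarrow> pr T \<Longrightarrow> pr (\<lambda>x. digit (b x) (p x) (T x))"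
  unfolding digit_def by (intro pr_intros)

lemma digit_less: "0 < b \<Longrightarrow> digit b p T < b"
  by (simp add: digit_def)

text \<open>
  This is how tape contents, and later the words and choice functions of a certificate, are
  assembled from their entries.
\<close>

lemma digit_sum:
  assumes "\<And>p. d p < b"
  shows "digit b q (\<Sum>p<N. d p * b ^ p) = (if q < N then d q else 0)"
  using assms
proof (induction q arbitrary: N d)
  case 0
  have b: "b > 0" using 0[of 0] by simp
  show ?case
  proof (cases N)
    case (Suc N')
    have "(\<Sum>p<N. d p * b ^ p) = d 0 + b * (\<Sum>p<N'. d (Suc p) * b ^ p)"
      unfolding Suc sum.lessThan_Suc_shift by (simp add: sum_distrib_left algebra_simps)
    then show ?thesis using 0[of 0] Suc by (simp add: digit_def)
  qed (simp add: digit_def)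
next
  case (Suc q)
  have b: "b > 0" using Suc.prems[of 0] by simp
  show ?case
  proof (cases N)
    case (Suc N')
    have "(\<Sum>p<N. d p * b ^ p) = d 0 + b * (\<Sum>p<N'. d (Suc p) * b ^ p)"
      unfolding Suc sum.lessThan_Suc_shift by (simp add: sum_distrib_left algebra_simps)
    then have "(\<Sum>p<N. d p * b ^ p) div b = (\<Sum>p<N'. d (Suc p) * b ^ p)"
      using Suc.prems[of 0] b by simp
    then have "digit b (Suc q) (\<Sum>p<N. d p * b ^ p) = digit b q (\<Sum>p<N'. d (Suc p) * b ^ p)"
      by (simp add: digit_def div_mult2_eq)
    then show ?thesis using Suc.IH[of "\<lambda>p. d (Suc p)" N'] Suc.prems Suc by simp
  qed (simp add: digit_def)
qed

lemma digit_eq_0: "2 \<le> b \<Longrightarrow> T \<le> p \<Longrightarrow> digit b p T = 0"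
proof -
  assume "2 \<le> b" "T \<le> p"
  have "p < 2 ^ p" by simp
  also have "2 ^ p \<le> b ^ p" using \<open>2 \<le> b\<close> by (rule power_mono) simp
  finally show ?thesis using \<open>T \<le> p\<close> by (simp add: digit_def)
qed

text \<open>
  The run is continued constantly after halting.  Thus the configuration after \<open>t\<close> steps is a total
  function of \<open>t\<close>, and halting within \<open>t\<close> steps is monotone in \<open>t\<close>.
\<close>

definition advance :: "machine \<Rightarrow> config \<Rightarrow> config" where
  "advance M c = (case step M c of None \<Rightarrow> c | Some c' \<Rightarrow> c')"

definition run :: "machine \<Rightarrow> nat \<Rightarrow> nat \<Rightarrow> config" where
  "run M n t = (advance M ^^ t) (init_config n)"

lemma run_Suc: "run M n (Suc t) = advance M (run M n t)"
  by (simp add: run_def)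

lemma run_halted: "step M (run M n t) = None \<Longrightarrow> t \<le> t' \<Longrightarrow> run M n t' = run M n t"
  by (induction t') (auto simp: le_Suc_eq run_Suc advance_def)

lemma halts_with_iff_run: "halts_with M n c \<longleftrightarrow> (\<exists>t. run M n t = c \<and> step M c = None)"
proof -
  have "\<exists>t. run M n t = c" if "(init_config n, c) \<in> (moves M)\<^sup>*" for c
    using that
  proof (induction rule: rtrancl_induct)
    case base
    show ?case by (rule exI[of _ 0]) (simp add: run_def)
  next
    case (step y z)
    then obtain t where "run M n t = y" by blast
    with step show ?case by (intro exI[of _ "Suc t"]) (simp add: run_Suc advance_def)
  qed
  moreover have "(init_config n, run M n t) \<in> (moves M)\<^sup>*" for t
  proof (induction t)
    case (Suc t)
    then show ?case
      by (cases "step M (run M n t)") (auto simp: run_Suc advance_def intro: steps_snoc)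
  qed (simp add: run_def)
  ultimately show ?thesis unfolding halts_with_def by blast
qed

definition halts_within :: "machine \<Rightarrow> nat \<Rightarrow> nat \<Rightarrow> bool" where
  "halts_within M n t \<longleftrightarrow> step M (run M n t) = None"

lemma halts_iff_within: "halts M n \<longleftrightarrow> (\<exists>t. halts_within M n t)"
  by (auto simp: halts_def halts_with_iff_run halts_within_def)

lemma halts_within_mono: "halts_within M n t \<Longrightarrow> t \<le> t' \<Longrightarrow> halts_within M n t'"
  unfolding halts_within_def by (metis run_halted)

definition tape_code :: "nat \<Rightarrow> nat \<Rightarrow> nat" where
  "tape_code i z = pfst (entry i (psnd z))"

definition head_code :: "nat \<Rightarrow> nat \<Rightarrow> nat" where
  "head_code i z = psnd (entry i (psnd z))"

lemma pr_tape_code [pr_intros]: "pr f \<Longrightarrow> pr (\<lambda>x. tape_code i (f x))"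
  unfolding tape_code_def by (intro pr_intros)

lemma pr_head_code [pr_intros]: "pr f \<Longrightarrow> pr (\<lambda>x. head_code i (f x))"
  unfolding head_code_def by (intro pr_intros)

text \<open>
  A code of a configuration consists of the state and of a pair for every tape: the number whose digits
  are the cells, and the head position.  The bound on the state is included because the transition
  table is finite only on legal states; legality of the symbols is automatic, as they are digits.
\<close>

definition represents :: "machine \<Rightarrow> nat \<Rightarrow> config \<Rightarrow> bool" where
  "represents M z c \<longleftrightarrow> pfst z = state c \<and> state c < num_states M \<and>
     (\<forall>i<num_tapes M. head_code i z = head c i \<and>
        (\<forall>p. digit (num_symbols M) p (tape_code i z) = tape c i p))"

text \<open>
  The transition function is an arbitrary function of a list of symbols, but only finitely many of its
  values matter; so each piece of information about it is a finite table.
\<close>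

lemma transition_table:
  "\<exists>h. pr h \<and> (\<forall>q xs. q < num_states M \<longrightarrow> length xs = num_tapes M \<longrightarrow>
      set xs \<subseteq> {..<num_symbols M} \<longrightarrow> h (prod_encode (q, tuple xs)) = F q xs)"
proof -
  let ?B = "{..<num_states M} \<times> {xs. set xs \<subseteq> {..<num_symbols M} \<and> length xs = num_tapes M}"
  let ?g = "\<lambda>z. F (pfst z) (map (\<lambda>i. entry i (psnd z)) [0..<num_tapes M])"
  have "finite ?B" by (intro finite_cartesian_product finite_lists_length_eq) auto
  then have "finite ((\<lambda>(q, xs). prod_encode (q, tuple xs)) ` ?B)" by blast
  from pr_finite_table[OF this, of ?g]
  obtain h where "pr h" and h: "\<And>x. x \<in> (\<lambda>(q, xs). prod_encode (q, tuple xs)) ` ?B \<Longrightarrow> h x = ?g x"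
    by blast
  have "h (prod_encode (q, tuple xs)) = F q xs"
    if "q < num_states M" "length xs = num_tapes M" "set xs \<subseteq> {..<num_symbols M}" for q xs
  proof -
    have "h (prod_encode (q, tuple xs)) = ?g (prod_encode (q, tuple xs))"
      using that by (intro h) (auto simp: image_iff)
    also have "map (\<lambda>i. entry i (tuple xs)) [0..<num_tapes M] = xs"
      using that by (intro nth_equalityI) auto
    then have "?g (prod_encode (q, tuple xs)) = F q xs" by simp
    finally show ?thesis .
  qed
  with \<open>pr h\<close> show ?thesis by blast
qed

fun move_code :: "move \<Rightarrow> nat" where
  "move_code Move_Left = 0"
| "move_code Stay = 1"
| "move_code Move_Right = 2"

lemma move_head_code: "move_head m p = p + move_code m - 1"
  by (cases m) auto

text \<open>
  The new content of a tape is assembled digit by digit from the old one, with the written symbol in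
  place of the scanned one.  A tape code \<open>T\<close> has no non-zero digit from position \<open>T\<close> on, which bounds the
  number of digits to be copied.
\<close>

lemma simulation_step:
  assumes M: "turing_machine M"
  obtains S H where "pr S" "pr_pred H"
    "\<And>z c. represents M z c \<Longrightarrow> H z \<longleftrightarrow> step M c = None"
    "\<And>z c. represents M z c \<Longrightarrow> represents M (S z) (advance M c)"
proof -
  let ?k = "num_tapes M" and ?b = "num_symbols M"
  have b: "2 \<le> ?b" using M by (simp add: turing_machine_def)
  define key where
    "key = (\<lambda>z. prod_encode (pfst z, tuple (map (\<lambda>i. digit ?b (head_code i z) (tape_code i z)) [0..<?k])))"
  have pr_key: "pr key" unfolding key_def by (intro pr_intros pr_tuple)
  define ok where "ok = (\<lambda>h F. pr h \<and> (\<forall>q xs. q < num_states M \<longrightarrow> length xs = ?k \<longrightarrow>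
      set xs \<subseteq> {..<?b} \<longrightarrow> h (prod_encode (q, tuple xs)) = (F q xs :: nat)))"
  have table: "\<exists>h. ok h F" for F unfolding ok_def by (rule transition_table)
  obtain hH where hH: "ok hH (\<lambda>q xs. of_bool (delta M q xs = None))" using table by blast
  obtain hQ where hQ: "ok hQ (\<lambda>q xs. fst (the (delta M q xs)))" using table by blast
  have "\<forall>i. \<exists>h. ok h (\<lambda>q xs. fst (snd (the (delta M q xs)) ! i))" using table by blast
  then obtain hW where hW: "\<And>i. ok (hW i) (\<lambda>q xs. fst (snd (the (delta M q xs)) ! i))" by metis
  have "\<forall>i. \<exists>h. ok h (\<lambda>q xs. move_code (snd (snd (the (delta M q xs)) ! i)))" using table by blast
  then obtain hV where hV: "\<And>i. ok (hV i) (\<lambda>q xs. move_code (snd (snd (the (delta M q xs)) ! i)))" by metis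
  define cells where "cells = (\<lambda>i z. \<Sum>p<tape_code i z + head_code i z + 1.
      (if p = head_code i z then hW i (key z) else digit ?b p (tape_code i z)) * ?b ^ p)"
  define S where "S = (\<lambda>z. if hH (key z) = 1 then z else
      prod_encode (hQ (key z), tuple (map (\<lambda>i. prod_encode (cells i z, head_code i z + hV i (key z) - 1)) [0..<?k])))"
  have prs: "pr (\<lambda>x. hH (key x))" "pr (\<lambda>x. hQ (key x))" "pr (\<lambda>x. hW i (key x))" "pr (\<lambda>x. hV i (key x))" for i
    using pr_comp[OF _ pr_key] hH hQ hW hV unfolding ok_def by blast+
  have pr_cells: "pr (cells i)" for i
    unfolding cells_def by (intro pr_intros prs pr_comp[OF prs(3)])
  show thesis
  proof
    show "pr S" unfolding S_def by (intro pr_intros pr_tuple prs pr_cells)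
    show "pr_pred (\<lambda>z. hH (key z) = 1)" by (intro pr_intros prs)
    fix z c assume zc: "represents M z c"
    have z: "pfst z = state c" "state c < num_states M" "\<And>i. i < ?k \<Longrightarrow> head_code i z = head c i"
      "\<And>i p. i < ?k \<Longrightarrow> digit ?b p (tape_code i z) = tape c i p"
      using zc by (auto simp: represents_def)
    let ?xs = "scanned M c"
    have key: "key z = prod_encode (state c, tuple ?xs)"
      unfolding key_def scanned_def using z
      by (auto intro!: arg_cong[where f = tuple] map_cong)
    have xs: "length ?xs = ?k" "set ?xs \<subseteq> {..<?b}"
      using z(4)[symmetric] digit_less[of ?b] b by (auto simp: scanned_def)
    have lookup: "h (key z) = F (state c) ?xs" if "ok h F" for h F
      using that xs z(2) unfolding ok_def key by blast
    show halted: "hH (key z) = 1 \<longleftrightarrow> step M c = None"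
      by (auto simp: lookup[OF hH] step_def split: option.splits)
    show "represents M (S z) (advance M c)"
    proof (cases "delta M (state c) ?xs")
      case None
      then have "step M c = None" by (simp add: step_def)
      then show ?thesis using halted zc by (simp add: S_def advance_def)
    next
      case (Some r)
      obtain q' as where r: "r = (q', as)" by fastforce
      have as: "q' < num_states M" "length as = ?k" "fst ` set as \<subseteq> {..<?b}"
        using M Some[unfolded r] xs z(2) unfolding turing_machine_def by blast+
      let ?c' = "advance M c"
      have c': "state ?c' = q'" "\<And>i. i < ?k \<Longrightarrow> tape ?c' i = (tape c i)(head c i := fst (as ! i))"
        "\<And>i. i < ?k \<Longrightarrow> head ?c' i = move_head (snd (as ! i)) (head c i)"
        using Some r by (auto simp: advance_def step_def)
      have "step M c \<noteq> None" using Some r by (simp add: step_def)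
      then have S: "S z = prod_encode (hQ (key z),
          tuple (map (\<lambda>i. prod_encode (cells i z, head_code i z + hV i (key z) - 1)) [0..<?k]))"
        using halted by (simp add: S_def del: not_None_eq)
      have "digit ?b p (cells i z) = tape ?c' i p" if i: "i < ?k" for i p
      proof -
        have "fst (as ! i) < ?b" using as i by (metis imageI lessThan_iff nth_mem subsetD)
        moreover have "hW i (key z) = fst (as ! i)" using lookup[OF hW] Some r by simp
        ultimately have "digit ?b p (cells i z) =
          (if p < tape_code i z + head_code i z + 1
           then if p = head_code i z then fst (as ! i) else digit ?b p (tape_code i z) else 0)"
          unfolding cells_def using b by (subst digit_sum) (auto simp: digit_less)
        then show ?thesis using c'(2)[OF i] z(3,4)[OF i] digit_eq_0[OF b, of "tape_code i z" p] by auto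
      qed
      moreover have "head_code i z + hV i (key z) - 1 = head ?c' i" if "i < ?k" for i
        using c'(3)[OF that] z(3)[OF that] lookup[OF hV] Some r by (simp add: move_head_code)
      moreover have "hQ (key z) = q'" using lookup[OF hQ] Some r by simp
      ultimately show ?thesis
        unfolding represents_def S using as(1) c'(1)
        by (simp add: tape_code_def head_code_def)
    qed
  qed
qed

lemma simulation:
  assumes M: "turing_machine M"
  shows "\<exists>R. pr R \<and> (\<forall>n t. represents M (R (prod_encode (n, t))) (run M n t))"
    and "pr_pred (\<lambda>z. halts_within M (pfst z) (psnd z))"
proof -
  let ?k = "num_tapes M" and ?b = "num_symbols M"
  have b: "2 \<le> ?b" using M by (simp add: turing_machine_def)
  obtain S H where SH: "pr S" "pr_pred H" "\<And>z c. represents M z c \<Longrightarrow> H z \<longleftrightarrow> step M c = None"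
    "\<And>z c. represents M z c \<Longrightarrow> represents M (S z) (advance M c)"
    using simulation_step[OF M] by blast
  define init where "init = (\<lambda>n. prod_encode (0, tuple (map (\<lambda>i. prod_encode
      (if i = 0 then \<Sum>p<n. 1 * ?b ^ p else 0, 0)) [0..<?k])))"
  have pr_init: "pr init" unfolding init_def
    by (intro pr_intros pr_tuple)
  have init: "represents M (init n) (init_config n)" for n
    using M b digit_sum[of "\<lambda>_. 1" ?b _ n]
    by (auto simp: represents_def init_def init_config_def tape_code_def head_code_def unary_def
        turing_machine_def digit_eq_0)
  define R where "R = (\<lambda>z. (S ^^ psnd z) (init (pfst z)))"
  have R: "represents M (R (prod_encode (n, t))) (run M n t)" for n t
    by (induction t) (auto simp: R_def run_def init SH(4))
  have pr_R: "pr R"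
    unfolding R_def by (intro pr_funpow SH pr_intros pr_comp[OF pr_init])
  have "H (R z) \<longleftrightarrow> halts_within M (pfst z) (psnd z)" for z
    using SH(3)[OF R, of "pfst z" "psnd z"] by (simp add: halts_within_def)
  with pr_comp[OF SH(2)[unfolded pr_pred_def] pr_R]
  show "pr_pred (\<lambda>z. halts_within M (pfst z) (psnd z))" by (simp add: pr_pred_def)
  show "\<exists>R. pr R \<and> (\<forall>n t. represents M (R (prod_encode (n, t))) (run M n t))"
    using pr_R R by blast
qed

lemma pr_pred_halts_within [pr_intros]:
  assumes "turing_machine M" "pr n" "pr t"
  shows "pr_pred (\<lambda>x. halts_within M (n x) (t x))"
proof -
  from pr_comp[OF simulation(2)[OF assms(1), unfolded pr_pred_def] pr_pair[OF assms(2,3)]] show ?thesis by (simp add: pr_pred_def)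
qed

text \<open>
  A computable function need not be primitive recursive, but its value is the limit of a primitive
  recursive function of an additional step bound \<open>t\<close>.  The value 0 stands for a computation that has not
  halted within \<open>t\<close> steps.  The output \<open>m\<close> is written in unary, hence it is the sum of the digits of the
  output tape.
\<close>

lemma computable_fun_approximation:
  assumes "computable_fun g"
  shows "\<exists>V. pr V \<and>
    (\<forall>n t. V (prod_encode (n, t)) = 0 \<or> V (prod_encode (n, t)) = Suc (g n)) \<and>
    (\<forall>n. \<exists>t\<^sub>0. \<forall>t\<ge>t\<^sub>0. V (prod_encode (n, t)) = Suc (g n))"
proof -
  obtain M where M: "turing_machine M" and g: "\<And>n. outputs M n (g n)"
    using assms unfolding computable_fun_def by blast
  let ?b = "num_symbols M"
  have b: "2 \<le> ?b" and k: "0 < num_tapes M" using M by (auto simp: turing_machine_def)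
  obtain R where pr_R: "pr R" and R: "\<And>n t. represents M (R (prod_encode (n, t))) (run M n t)"
    using simulation(1)[OF M] by blast
  define V where "V = (\<lambda>z. if halts_within M (pfst z) (psnd z)
      then Suc (\<Sum>p<tape_code 0 (R z). digit ?b p (tape_code 0 (R z))) else 0)"
  have V: "V (prod_encode (n, t)) = Suc (g n)" if t: "halts_within M n t" for n t
  proof -
    let ?T = "tape_code 0 (R (prod_encode (n, t)))"
    obtain c where "halts_with M n c" and c: "tape c 0 = unary (g n)"
      using g unfolding outputs_def by blast
    then obtain t' where t': "run M n t' = c" "step M c = None" by (auto simp: halts_with_iff_run)
    have "run M n t = run M n t'"
      using run_halted[of M n t t'] run_halted[of M n t' t] t t' unfolding halts_within_def
      by (metis nle_le)
    then have dig: "digit ?b p ?T = unary (g n) p" for p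
      using R[of n t] k c t' by (simp add: represents_def)
    have "p < ?T" if "p < g n" for p
      using dig[of p] digit_eq_0[OF b, of ?T p] that by (force simp: unary_def not_less[symmetric])
    then have "{..<?T} \<inter> {p. p < g n} = {..<g n}" by auto
    then have "(\<Sum>p<?T. digit ?b p ?T) = g n"
      by (simp add: dig unary_def sum.If_cases)
    then show ?thesis using t by (simp add: V_def)
  qed
  have V0: "V (prod_encode (n, t)) = 0" if "\<not> halts_within M n t" for n t
    using that by (simp add: V_def)
  show ?thesis
  proof (intro exI[of _ V] conjI allI)
    show "pr V"
    proof -
      have T: "pr (\<lambda>z. tape_code 0 (R (pfst z)))" by (intro pr_intros pr_comp[OF pr_R])
      show ?thesis unfolding V_def by (intro pr_intros M T pr_tape_code pr_R)
    qed
    show "V (prod_encode (n, t)) = 0 \<or> V (prod_encode (n, t)) = Suc (g n)" for n t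
      using V V0 by blast
    show "\<exists>t\<^sub>0. \<forall>t\<ge>t\<^sub>0. V (prod_encode (n, t)) = Suc (g n)" for n
    proof -
      obtain c where "halts_with M n c" using g unfolding outputs_def by blast
      then have "halts M n" unfolding halts_def by blast
      then obtain t where "halts_within M n t" using halts_iff_within by blast
      then show ?thesis using V halts_within_mono by blast
    qed
  qed
qed

section \<open>Entropy of expansive systems\<close>

lemma funpow_mem: "f ` K \<subseteq> K \<Longrightarrow> x \<in> K \<Longrightarrow> (f ^^ k) x \<in> K"
  by (induction k) auto

lemma cover_joinE:
  assumes "A \<in> cover_join f \<U> n"
  obtains U where "\<And>k. k < n \<Longrightarrow> U k \<in> \<U>" "\<And>x. x \<in> A \<longleftrightarrow> (\<forall>k<n. (f ^^ k) x \<in> U k)"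
proof -
  from assms obtain U where "A = (\<Inter>k<n. (f ^^ k) -` U k)" "\<forall>k<n. U k \<in> \<U>"
    unfolding cover_join_def by blast
  then show thesis using that[of U] by auto
qed

lemma cover_joinI:
  assumes "\<And>k. k < n \<Longrightarrow> U k \<in> \<U>"
  shows "{x. \<forall>k<n. (f ^^ k) x \<in> U k} \<in> cover_join f \<U> n"
  unfolding cover_join_def using assms by (intro CollectI exI[of _ U]) auto

lemma finite_cover_join:
  assumes "finite \<U>" shows "finite (cover_join f \<U> n)"
proof -
  have "cover_join f \<U> n \<subseteq> (\<lambda>U. \<Inter>k<n. (f ^^ k) -` U k) ` ({..<n} \<rightarrow>\<^sub>E \<U>)"
  proof
    fix A assume "A \<in> cover_join f \<U> n"
    then obtain U where U: "A = (\<Inter>k<n. (f ^^ k) -` U k)" "\<forall>k<n. U k \<in> \<U>"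
      by (auto simp: cover_join_def)
    then show "A \<in> (\<lambda>U. \<Inter>k<n. (f ^^ k) -` U k) ` ({..<n} \<rightarrow>\<^sub>E \<U>)"
      by (intro image_eqI[of _ _ "restrict U {..<n}"]) auto
  qed
  then show ?thesis using finite_subset finite_PiE[of "{..<n}" "\<lambda>_. \<U>"] assms by blast
qed

lemma cover_join_covers:
  assumes "K \<subseteq> \<Union>\<U>" "f ` K \<subseteq> K"
  shows "K \<subseteq> \<Union>(cover_join f \<U> n)"
proof
  fix x assume "x \<in> K"
  then have "(f ^^ k) x \<in> \<Union>\<U>" for k using assms(1) funpow_mem[OF assms(2), of x k] by blast
  then have "\<forall>k. \<exists>U\<in>\<U>. (f ^^ k) x \<in> U" by blast
  then obtain U where "\<And>k. U k \<in> \<U>" "\<And>k. (f ^^ k) x \<in> U k" by metis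
  then have "x \<in> (\<Inter>k<n. (f ^^ k) -` U k)" "(\<Inter>k<n. (f ^^ k) -` U k) \<in> cover_join f \<U> n"
    by (auto simp: cover_join_def)
  then show "x \<in> \<Union>(cover_join f \<U> n)" by blast
qed

lemma cover_number_attained:
  assumes "finite \<U>" "K \<subseteq> \<Union>\<U>" "f ` K \<subseteq> K"
  obtains \<C> where "\<C> \<subseteq> cover_join f \<U> n" "K \<subseteq> \<Union>\<C>" "finite \<C>" "card \<C> = cover_number K f \<U> n"
proof -
  have "\<exists>m \<C>. \<C> \<subseteq> cover_join f \<U> n \<and> K \<subseteq> \<Union>\<C> \<and> finite \<C> \<and> card \<C> = m"
    using finite_cover_join[OF assms(1)] cover_join_covers[OF assms(2,3)] by blast
  from LeastI_ex[OF this] that show thesis unfolding cover_number_def by blast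
qed

lemma cover_number_le:
  "\<C> \<subseteq> cover_join f \<U> n \<Longrightarrow> K \<subseteq> \<Union>\<C> \<Longrightarrow> finite \<C> \<Longrightarrow> cover_number K f \<U> n \<le> card \<C>"
  unfolding cover_number_def by (rule Least_le) blast

lemma cover_number_pos:
  assumes "finite \<U>" "K \<subseteq> \<Union>\<U>" "f ` K \<subseteq> K" "K \<noteq> {}"
  shows "1 \<le> cover_number K f \<U> n"
proof -
  obtain \<C> where "K \<subseteq> \<Union>\<C>" "finite \<C>" "card \<C> = cover_number K f \<U> n"
    using cover_number_attained[OF assms(1-3)] by metis
  then show ?thesis using assms(4) by (metis Sup_empty card_0_eq less_one not_le subset_empty)
qed

text \<open>
  By invariance, the orbit of a point of \<open>K\<close> is in \<open>K\<close> again after \<open>a\<close> steps, where the cover for the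
  remaining \<open>b\<close> steps applies.
\<close>

lemma cover_number_add:
  assumes "finite \<U>" "K \<subseteq> \<Union>\<U>" "f ` K \<subseteq> K"
  shows "cover_number K f \<U> (a + b) \<le> cover_number K f \<U> a * cover_number K f \<U> b"
proof -
  obtain \<A> where A: "\<A> \<subseteq> cover_join f \<U> a" "K \<subseteq> \<Union>\<A>" "finite \<A>" "card \<A> = cover_number K f \<U> a"
    by (rule cover_number_attained[OF assms])
  obtain \<B> where B: "\<B> \<subseteq> cover_join f \<U> b" "K \<subseteq> \<Union>\<B>" "finite \<B>" "card \<B> = cover_number K f \<U> b"
    by (rule cover_number_attained[OF assms])
  let ?C = "(\<lambda>(A, B). A \<inter> (f ^^ a) -` B) ` (\<A> \<times> \<B>)"
  have "?C \<subseteq> cover_join f \<U> (a + b)"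
  proof (rule image_subsetI)
    fix p assume "p \<in> \<A> \<times> \<B>"
    then obtain A B where p: "p = (A, B)" and "A \<in> cover_join f \<U> a" "B \<in> cover_join f \<U> b"
      using A(1) B(1) by (cases p) auto
    then obtain U V where U: "\<And>k. k < a \<Longrightarrow> U k \<in> \<U>" "\<And>x. x \<in> A \<longleftrightarrow> (\<forall>k<a. (f ^^ k) x \<in> U k)"
      and V: "\<And>k. k < b \<Longrightarrow> V k \<in> \<U>" "\<And>x. x \<in> B \<longleftrightarrow> (\<forall>k<b. (f ^^ k) x \<in> V k)"
      by (elim cover_joinE) metis
    let ?W = "\<lambda>k. if k < a then U k else V (k - a)"
    have "x \<in> A \<inter> (f ^^ a) -` B \<longleftrightarrow> (\<forall>k<a + b. (f ^^ k) x \<in> ?W k)" for x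
    proof (intro iffI allI impI)
      fix k assume x: "x \<in> A \<inter> (f ^^ a) -` B" and k: "k < a + b"
      show "(f ^^ k) x \<in> ?W k"
      proof (cases "k < a")
        case False
        then have "k - a < b" using k by simp
        with x V(2) have "(f ^^ (k - a)) ((f ^^ a) x) \<in> V (k - a)" by simp
        with False show ?thesis using funpow_add[of "k - a" a f] by simp
      qed (use x U in simp)
    next
      assume x: "\<forall>k<a + b. (f ^^ k) x \<in> ?W k"
      have "(f ^^ k) x \<in> U k" if "k < a" for k using x[rule_format, of k] that by simp
      moreover have "(f ^^ k) ((f ^^ a) x) \<in> V k" if "k < b" for k
        using x[rule_format, of "k + a"] that by (simp add: funpow_add)
      ultimately show "x \<in> A \<inter> (f ^^ a) -` B" using U(2) V(2) by simp
    qed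
    then have "A \<inter> (f ^^ a) -` B = {x. \<forall>k<a + b. (f ^^ k) x \<in> ?W k}" by blast
    also have "\<dots> \<in> cover_join f \<U> (a + b)" by (rule cover_joinI) (use U V in auto)
    finally show "(case p of (A, B) \<Rightarrow> A \<inter> (f ^^ a) -` B) \<in> cover_join f \<U> (a + b)"
      by (simp add: p)
  qed
  moreover have "K \<subseteq> \<Union>?C"
  proof
    fix x assume "x \<in> K"
    then have "(f ^^ a) x \<in> K" by (rule funpow_mem[OF assms(3)])
    then obtain B where "B \<in> \<B>" "(f ^^ a) x \<in> B" using B(2) by (meson UnionE subsetD)
    moreover obtain A where "A \<in> \<A>" "x \<in> A" using A(2) \<open>x \<in> K\<close> by (meson UnionE subsetD)
    ultimately show "x \<in> \<Union>?C" by (intro UnionI[of "A \<inter> (f ^^ a) -` B"]) auto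
  qed
  ultimately have "cover_number K f \<U> (a + b) \<le> card ?C"
    using A B by (intro cover_number_le) auto
  also have "\<dots> \<le> card (\<A> \<times> \<B>)" using A B by (intro card_image_le) auto
  finally show ?thesis using A B by (simp add: card_cartesian_product)
qed

lemma cover_number_mult:
  assumes "finite \<U>" "K \<subseteq> \<Union>\<U>" "f ` K \<subseteq> K"
  shows "cover_number K f \<U> (q * n) \<le> cover_number K f \<U> n ^ q"
proof (induction q)
  case 0
  have "cover_number K f \<U> 0 \<le> card {UNIV :: 'a set}"
    by (rule cover_number_le) (auto simp: cover_join_def)
  then show ?case by simp
next
  case (Suc q)
  have "cover_number K f \<U> (Suc q * n) \<le> cover_number K f \<U> n * cover_number K f \<U> (q * n)"
    using cover_number_add[OF assms, of n "q * n"] by simp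
  also have "\<dots> \<le> cover_number K f \<U> n ^ Suc q" using Suc by simp
  finally show ?case .
qed

text \<open>
  Inside a word of length \<open>n + m\<close> over \<open>\<U>\<close>, a window of length \<open>m\<close> starts at each time \<open>k < n\<close>, and the
  hypothesis turns this window into one letter from \<open>\<V>\<close>.  It applies only to members of the join
  that meet \<open>K\<close>; the other members of a subcover can be discarded.
\<close>

lemma cover_number_refine:
  assumes U: "finite \<U>" "K \<subseteq> \<Union>\<U>" and K: "f ` K \<subseteq> K"
    and refine: "\<And>x A. x \<in> K \<Longrightarrow> x \<in> A \<Longrightarrow> A \<in> cover_join f \<U> m \<Longrightarrow> \<exists>V\<in>\<V>. A \<subseteq> V"
  shows "cover_number K f \<V> n \<le> cover_number K f \<U> (n + m)"
proof -
  obtain \<C> where C: "\<C> \<subseteq> cover_join f \<U> (n + m)" "K \<subseteq> \<Union>\<C>" "finite \<C>"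
      "card \<C> = cover_number K f \<U> (n + m)"
    by (rule cover_number_attained[OF U K])
  define \<C>' where "\<C>' = {A \<in> \<C>. A \<inter> K \<noteq> {}}"
  have "\<forall>A\<in>\<C>'. \<exists>B\<in>cover_join f \<V> n. A \<subseteq> B"
  proof
    fix A assume "A \<in> \<C>'"
    then obtain x where x: "x \<in> A" "x \<in> K" and "A \<in> cover_join f \<U> (n + m)"
      using C(1) unfolding \<C>'_def by blast
    then obtain U where U: "\<And>k. k < n + m \<Longrightarrow> U k \<in> \<U>"
      and A: "\<And>x. x \<in> A \<longleftrightarrow> (\<forall>k<n + m. (f ^^ k) x \<in> U k)" by (elim cover_joinE) metis
    let ?A = "\<lambda>k. {x. \<forall>j<m. (f ^^ j) x \<in> U (k + j)}"
    have sub: "(f ^^ k) y \<in> ?A k" if k: "k < n" and y: "y \<in> A" for k y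
    proof -
      have "(f ^^ (j + k)) y \<in> U (k + j)" if "j < m" for j
        using A[of y] y that k by (simp add: add.commute)
      then show ?thesis by (simp add: funpow_add)
    qed
    have "\<exists>V\<in>\<V>. ?A k \<subseteq> V" if k: "k < n" for k
    proof (rule refine)
      show "(f ^^ k) x \<in> K" by (rule funpow_mem[OF K x(2)])
      show "(f ^^ k) x \<in> ?A k" using sub[OF k x(1)] .
      show "?A k \<in> cover_join f \<U> m" by (rule cover_joinI) (use U k in simp)
    qed
    then have "\<forall>k\<in>{..<n}. \<exists>V. V \<in> \<V> \<and> ?A k \<subseteq> V" by blast
    from bchoice[OF this] obtain V where V: "\<And>k. k < n \<Longrightarrow> V k \<in> \<V>" "\<And>k. k < n \<Longrightarrow> ?A k \<subseteq> V k"
      by blast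
    have "A \<subseteq> {x. \<forall>k<n. (f ^^ k) x \<in> V k}" using sub V(2) by blast
    moreover have "{x. \<forall>k<n. (f ^^ k) x \<in> V k} \<in> cover_join f \<V> n"
      by (rule cover_joinI) (rule V(1))
    ultimately show "\<exists>B\<in>cover_join f \<V> n. A \<subseteq> B" by blast
  qed
  then obtain g where g: "\<And>A. A \<in> \<C>' \<Longrightarrow> g A \<in> cover_join f \<V> n" "\<And>A. A \<in> \<C>' \<Longrightarrow> A \<subseteq> g A" by metis
  have fin: "finite \<C>'" using C(3) by (simp add: \<C>'_def)
  have "K \<subseteq> \<Union>(g ` \<C>')"
  proof
    fix x assume "x \<in> K"
    then obtain A where "A \<in> \<C>'" "x \<in> A" using C(2) unfolding \<C>'_def by blast
    then show "x \<in> \<Union>(g ` \<C>')" using g(2) by blast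
  qed
  then have "cover_number K f \<V> n \<le> card (g ` \<C>')"
    using g(1) fin by (intro cover_number_le) auto
  also have "\<dots> \<le> card \<C>'" by (rule card_image_le[OF fin])
  also have "\<dots> \<le> card \<C>" using C(3) by (intro card_mono) (auto simp: \<C>'_def)
  finally show ?thesis using C(4) by simp
qed

lemma cover_entropy_lower:
  assumes "finite \<U>" "K \<subseteq> \<Union>\<U>" "f ` K \<subseteq> K" "K \<noteq> {}" "1 \<le> n"
  shows "cover_entropy K f \<U> \<le> log 2 (cover_number K f \<U> n) / n"
  unfolding cover_entropy_def
proof (rule cINF_lower)
  show "bdd_below ((\<lambda>n. log 2 (cover_number K f \<U> n) / n) ` {1..})"
    by (rule bdd_belowI2[of _ 0]) (use cover_number_pos[OF assms(1-4)] in \<open>simp add: zero_le_log_cancel_iff Suc_le_eq\<close>)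
qed (use assms in simp)

text \<open>
  The shift by \<open>m\<close> disappears in the limit.  Since the entropy of a cover is defined as an infimum, this
  is seen along the multiples \<open>q * n\<close> of a fixed \<open>n\<close>: submultiplicativity bounds the \<open>q * n\<close>-th
  cover number of \<open>\<V>\<close> by the \<open>q\<close>-th power of the \<open>n\<close>-th cover number of \<open>\<U>\<close> times a constant.
\<close>

lemma cover_entropy_refine:
  assumes U: "finite \<U>" "K \<subseteq> \<Union>\<U>" and V: "finite \<V>" "K \<subseteq> \<Union>\<V>"
    and K: "f ` K \<subseteq> K" "K \<noteq> {}"
    and refine: "\<And>x A. x \<in> K \<Longrightarrow> x \<in> A \<Longrightarrow> A \<in> cover_join f \<U> m \<Longrightarrow> \<exists>V\<in>\<V>. A \<subseteq> V"
  shows "cover_entropy K f \<V> \<le> cover_entropy K f \<U>"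
  unfolding cover_entropy_def[of K f \<U>]
proof (rule cINF_greatest)
  fix n :: nat assume n: "n \<in> {1..}"
  let ?N = "cover_number K f \<U>" and ?M = "cover_number K f \<V>"
  have pos: "1 \<le> ?N k" "1 \<le> ?M k" for k
    using cover_number_pos[OF U K] cover_number_pos[OF V K] by auto
  have bound: "cover_entropy K f \<V> \<le> log 2 (?N n) / n + log 2 (?N m) / n / real q" if q: "1 \<le> q" for q
  proof -
    have "?M (q * n) \<le> ?N (q * n + m)"
      by (rule cover_number_refine[OF U K(1) refine])
    also have "\<dots> \<le> ?N (q * n) * ?N m" by (rule cover_number_add[OF U K(1)])
    also have "\<dots> \<le> ?N n ^ q * ?N m" using cover_number_mult[OF U K(1)] by simp
    finally have "real (?M (q * n)) \<le> real (?N n ^ q * ?N m)" by (simp only: of_nat_le_iff)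
    then have "log 2 (?M (q * n)) \<le> log 2 (real (?N n) ^ q * ?N m)"
      using pos(2)[of "q * n"] by (intro log_mono) auto
    also have "\<dots> = q * log 2 (?N n) + log 2 (?N m)"
      using pos(1)[of n] pos(1)[of m] by (simp add: log_mult log_nat_power)
    finally have le: "log 2 (?M (q * n)) \<le> q * log 2 (?N n) + log 2 (?N m)" .
    have "cover_entropy K f \<V> \<le> log 2 (?M (q * n)) / real (q * n)"
      by (rule cover_entropy_lower[OF V K]) (use n q in auto)
    also have "\<dots> \<le> (q * log 2 (?N n) + log 2 (?N m)) / real (q * n)"
      using le by (rule divide_right_mono) simp
    also have "\<dots> = log 2 (?N n) / n + log 2 (?N m) / n / real q"
      using n q by (simp add: field_simps)
    finally show ?thesis .
  qed
  have "(\<lambda>q. log 2 (?N n) / n + log 2 (?N m) / n / real q) \<longlonglongrightarrow> log 2 (?N n) / n + 0"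
    by (intro tendsto_add tendsto_const lim_const_over_n)
  then show "cover_entropy K f \<V> \<le> log 2 (?N n) / n"
    using bound by (auto intro!: LIMSEQ_le_const)
qed simp

text \<open>
  Compactness of the product space: the closed sets of pairs at distance at least \<open>\<delta>\<close> whose orbits are
  \<open>\<beta>\<close>-close at a given time have empty intersection by expansiveness, so finitely many times suffice.
\<close>

lemma expansive_uniformly:
  fixes f :: "'a::metric_space \<Rightarrow> 'a"
  assumes X: "compact (UNIV :: 'a set)" and f: "continuous_on UNIV f"
    and exp: "\<And>x y. x \<noteq> y \<Longrightarrow> \<exists>n. \<alpha> \<le> dist ((f ^^ n) x) ((f ^^ n) y)"
    and "\<beta> < \<alpha>" "0 < \<delta>"
  obtains m where "\<And>x y. (\<And>k. k < m \<Longrightarrow> dist ((f ^^ k) x) ((f ^^ k) y) \<le> \<beta>) \<Longrightarrow> dist x y < \<delta>"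
proof -
  have cont: "continuous_on UNIV (f ^^ k)" for k
    by (induction k) (auto intro: continuous_on_compose2[OF f])
  define F where "F = (\<lambda>k. {p :: 'a \<times> 'a. dist ((f ^^ k) (fst p)) ((f ^^ k) (snd p)) \<le> \<beta>})"
  let ?D = "{p :: 'a \<times> 'a. \<delta> \<le> dist (fst p) (snd p)}"
  have closed_D: "closed ?D"
    by (intro closed_Collect_le continuous_intros)
  have closed_F: "closed (F k)" for k
    unfolding F_def
    by (intro closed_Collect_le continuous_on_dist continuous_on_const
        continuous_on_compose2[OF cont] continuous_on_fst continuous_on_snd continuous_on_id) auto
  have "compact (UNIV :: ('a \<times> 'a) set)"
    using compact_Times[OF X X] by simp
  then have "compact ?D"
    using compact_Int_closed[OF _ closed_D] by fastforce
  moreover have "?D \<inter> (\<Inter>k. F k) = {}"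
  proof -
    have False if D: "p \<in> ?D" and F: "\<And>k. p \<in> F k" for p
    proof -
      have "fst p \<noteq> snd p" using D \<open>0 < \<delta>\<close> by auto
      then obtain n where "\<alpha> \<le> dist ((f ^^ n) (fst p)) ((f ^^ n) (snd p))" using exp by blast
      with F[of n] \<open>\<beta> < \<alpha>\<close> show False by (simp add: F_def)
    qed
    then show ?thesis by blast
  qed
  ultimately obtain J where J: "finite J" "?D \<inter> (\<Inter>k\<in>J. F k) = {}"
    using compact_imp_fip_image[of ?D UNIV F] closed_F by (metis subset_UNIV)
  show thesis
  proof (rule that[of "Suc (Max (insert 0 J))"])
    fix x y assume *: "\<And>k. k < Suc (Max (insert 0 J)) \<Longrightarrow> dist ((f ^^ k) x) ((f ^^ k) y) \<le> \<beta>"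
    have "(x, y) \<in> (\<Inter>k\<in>J. F k)"
      using * J(1) by (auto simp: F_def less_Suc_eq_le)
    then have "(x, y) \<notin> ?D" using J(2) by blast
    then show "dist x y < \<delta>" by simp
  qed
qed

text \<open>
  Given another cover, take a Lebesgue number \<open>\<delta>\<close> of it on \<open>K\<close>.  Two points of the same member of a long
  join of \<open>\<U>\<close> have \<open>\<beta>\<close>-close orbits for a long time, so they are \<open>\<delta>\<close>-close, and the join refines the
  other cover.  Hence \<open>\<U>\<close> alone attains the supremum in the definition of the entropy.
\<close>

theorem entropy_of_generating_cover:
  fixes f :: "'a::metric_space \<Rightarrow> 'a"
  assumes X: "compact (UNIV :: 'a set)" and dyn: "dynamical_system K f"
    and exp: "\<And>x y. x \<noteq> y \<Longrightarrow> \<exists>n. \<alpha> \<le> dist ((f ^^ n) x) ((f ^^ n) y)"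
    and U: "finite \<U>" "open_cover K \<U>"
    and small: "\<And>A x y. A \<in> \<U> \<Longrightarrow> x \<in> A \<Longrightarrow> y \<in> A \<Longrightarrow> dist x y \<le> \<beta>" and "\<beta> < \<alpha>"
  shows "topological_entropy K f = ereal (cover_entropy K f \<U>)"
proof -
  have f: "continuous_on UNIV f" and K: "f ` K \<subseteq> K" "K \<noteq> {}" "compact K"
    using dyn by (auto simp: dynamical_system_def)
  have KU: "K \<subseteq> \<Union>\<U>" using U by (simp add: open_cover_def)
  have "cover_entropy K f \<V> \<le> cover_entropy K f \<U>" if V: "finite \<V>" "open_cover K \<V>" for \<V>
  proof -
    have V': "K \<subseteq> \<Union>\<V>" "\<And>B. B \<in> \<V> \<Longrightarrow> open B" using V by (auto simp: open_cover_def)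
    obtain \<delta> where \<delta>: "0 < \<delta>" "\<And>x. x \<in> K \<Longrightarrow> \<exists>B\<in>\<V>. ball x \<delta> \<subseteq> B"
      using Heine_Borel_lemma[OF K(3) V'] by metis
    obtain m where m: "\<And>x y. (\<And>k. k < m \<Longrightarrow> dist ((f ^^ k) x) ((f ^^ k) y) \<le> \<beta>) \<Longrightarrow> dist x y < \<delta>"
      using expansive_uniformly[OF X f exp \<open>\<beta> < \<alpha>\<close> \<delta>(1)] by metis
    show ?thesis
    proof (rule cover_entropy_refine[OF U(1) KU V(1) V'(1) K(1,2)])
      fix x A assume x: "x \<in> K" "x \<in> A" and "A \<in> cover_join f \<U> m"
      then obtain W where W: "\<And>k. k < m \<Longrightarrow> W k \<in> \<U>" "\<And>x. x \<in> A \<longleftrightarrow> (\<forall>k<m. (f ^^ k) x \<in> W k)"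
        by (elim cover_joinE) metis
      have "A \<subseteq> ball x \<delta>"
      proof
        fix y assume y: "y \<in> A"
        have "dist x y < \<delta>"
          by (rule m) (use W x(2) y small in blast)
        then show "y \<in> ball x \<delta>" by simp
      qed
      then show "\<exists>V\<in>\<V>. A \<subseteq> V" using \<delta>(2)[OF x(1)] by blast
    qed
  qed
  then show ?thesis unfolding topological_entropy_def
    using U by (intro antisym SUP_least SUP_upper2[of \<U>]) auto
qed

section \<open>Finite certificates for cover numbers\<close>

lemma pr_pred_mem_set_decode [pr_intros]:
  assumes "pr i" "pr S" shows "pr_pred (\<lambda>x. i x \<in> set_decode (S x))"
proof -
  have "pr_pred (\<lambda>x. (S x div 2 ^ i x) mod 2 = 1)" by (intro pr_intros assms)
  then show ?thesis by (simp add: set_decode_def odd_iff_mod_2_eq_one)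
qed

lemma pr_set_encode [pr_intros]:
  assumes "pr_pred (\<lambda>z. P (pfst z) (psnd z))" "pr b"
  shows "pr (\<lambda>x. set_encode {i. i < b x \<and> P x i})"
proof -
  have "set_encode {i. i < m \<and> Q i} = (\<Sum>i<m. of_bool (Q i) * 2 ^ i)" for m Q
    using sum.inter_filter[of "{..<m}" "\<lambda>i. 2 ^ i" Q]
    by (auto simp: set_encode_def intro!: sum.cong)
  moreover have "pr (\<lambda>x. \<Sum>i<b x. of_bool (P x i) * 2 ^ i)" by (intro pr_intros assms)
  ultimately show ?thesis by simp
qed

text \<open>
  Stage \<open>t\<close> of the pullback of a union of balls under \<open>f\<close>, where \<open>V\<close> approximates an enumeration \<open>e\<close> of
  the balls that make up the preimages of balls: a ball \<open>i\<close> is accepted if \<open>e\<close> lists it, at a place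
  \<open>u < t\<close>, for some ball \<open>i'\<close> of \<open>A\<close>.  In \<open>Suc (Suc i)\<close> one successor comes from \<open>V\<close> (the computation of
  \<open>e\<close> has halted), the other one from \<open>e\<close> (the place is not empty).
\<close>

definition pullback_step :: "(nat \<Rightarrow> nat) \<Rightarrow> nat \<Rightarrow> nat set \<Rightarrow> nat set" where
  "pullback_step V t A = {i. i < t \<and> (\<exists>i'<t. i' \<in> A \<and>
     (\<exists>u<t. V (prod_encode (prod_encode (i', u), t)) = Suc (Suc i)))}"

text \<open>
  The balls that are known at stage \<open>t\<close> to be contained in the preimage of ball \<open>j\<close> under \<open>f ^^ k\<close>.
\<close>

definition pullback :: "(nat \<Rightarrow> nat) \<Rightarrow> nat \<Rightarrow> nat \<Rightarrow> nat \<Rightarrow> nat set" where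
  "pullback V t k j = (pullback_step V t ^^ k) {j}"

lemma finite_pullback: "finite (pullback V t k j)"
  by (cases k) (auto simp: pullback_def pullback_step_def)

lemma pr_pred_mem_pullback:
  assumes V: "pr V" and "pr t" "pr k" "pr j" "pr i"
  shows "pr_pred (\<lambda>x. i x \<in> pullback V (t x) (k x) (j x))"
proof -
  have V': "pr (\<lambda>x. V (f x))" if "pr f" for f using pr_comp[OF V that] .
  let ?code = "\<lambda>t k j. rec_nat (2 ^ j) (\<lambda>_ S. set_encode (pullback_step V t (set_decode S))) k"
  have code: "?code t k j = set_encode (pullback V t k j)" for t k j
  proof (induction k)
    case (Suc k)
    have "?code t (Suc k) j = set_encode (pullback_step V t (set_decode (?code t k j)))" by simp
    also have "set_decode (?code t k j) = pullback V t k j"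
      unfolding Suc by (rule set_encode_inverse[OF finite_pullback])
    finally show ?case by (simp add: pullback_def)
  qed (simp add: pullback_def)
  have "pr (\<lambda>z. ?code (pfst z) (pfst (psnd z)) (psnd (psnd z)))"
    unfolding pullback_step_def by (intro pr_intros V')
  from pr_comp[OF this, of "\<lambda>x. prod_encode (t x, prod_encode (k x, j x))"]
  have "pr (\<lambda>x. set_encode (pullback V (t x) (k x) (j x)))" using assms by (simp add: code pr_intros)
  then have "pr_pred (\<lambda>x. i x \<in> set_decode (set_encode (pullback V (t x) (k x) (j x))))"
    by (intro pr_intros assms)
  then show ?thesis by (simp add: finite_pullback)
qed

lemma pullback_sound:
  assumes V: "\<And>n t. V (prod_encode (n, t)) = 0 \<or> V (prod_encode (n, t)) = Suc (e n)"
    and e: "\<And>m. f -` B m = (\<Union>i\<in>{i. \<exists>u. e (prod_encode (m, u)) = Suc i}. B i)"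
  shows "i \<in> pullback V t k j \<Longrightarrow> x \<in> B i \<Longrightarrow> (f ^^ k) x \<in> B j"
proof (induction k arbitrary: i x)
  case 0
  then show ?case by (simp add: pullback_def)
next
  case (Suc k)
  then obtain i' u where i': "i' \<in> pullback V t k j" and "V (prod_encode (prod_encode (i', u), t)) = Suc (Suc i)"
    by (auto simp: pullback_def pullback_step_def)
  then have "e (prod_encode (i', u)) = Suc i" using V[of "prod_encode (i', u)" t] by simp
  then have "f x \<in> B i'" using e[of i'] Suc.prems(2) by blast
  then have "(f ^^ k) (f x) \<in> B j" by (rule Suc.IH[OF i'])
  then show ?case by (simp add: funpow_swap1)
qed

lemma pullback_complete:
  assumes V: "\<And>n. \<forall>\<^sub>F t in sequentially. V (prod_encode (n, t)) = Suc (e n)"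
    and e: "\<And>m. f -` B m = (\<Union>i\<in>{i. \<exists>u. e (prod_encode (m, u)) = Suc i}. B i)"
  shows "(f ^^ k) x \<in> B j \<Longrightarrow> \<exists>i. x \<in> B i \<and> (\<forall>\<^sub>F t in sequentially. i \<in> pullback V t k j)"
proof (induction k arbitrary: x)
  case 0
  then show ?case by (auto simp: pullback_def)
next
  case (Suc k)
  then have "(f ^^ k) (f x) \<in> B j" by (simp add: funpow_swap1)
  from Suc.IH[OF this] obtain i' where i': "f x \<in> B i'" "\<forall>\<^sub>F t in sequentially. i' \<in> pullback V t k j" by blast
  then obtain i u where i: "x \<in> B i" and u: "e (prod_encode (i', u)) = Suc i"
    using e[of i'] by blast
  have "\<forall>\<^sub>F t in sequentially. i \<in> pullback V t (Suc k) j"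
    using i'(2) V[of "prod_encode (i', u)"] eventually_gt_at_top[of i'] eventually_gt_at_top[of i]
      eventually_gt_at_top[of u]
    by eventually_elim (auto simp: pullback_def pullback_step_def u)
  with i show ?case by blast
qed

text \<open>
  The balls that are known at stage \<open>t\<close> to be contained in the complement of \<open>K\<close> or in one of the sets
  \<open>(f ^^ \<phi> l) -` B (J (w l (\<phi> l)))\<close> with \<open>l < m\<close>.
\<close>

definition verified_balls ::
    "machine \<Rightarrow> (nat \<Rightarrow> nat) \<Rightarrow> nat \<Rightarrow> (nat \<Rightarrow> nat) \<Rightarrow> nat \<Rightarrow> (nat \<Rightarrow> nat \<Rightarrow> nat) \<Rightarrow> (nat \<Rightarrow> nat) \<Rightarrow> nat set" where
  "verified_balls MK V t J m w \<phi> =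
     {i. i < t \<and> (halts_within MK i t \<or> (\<exists>l<m. i \<in> pullback V t (\<phi> l) (J (w l (\<phi> l)))))}"

text \<open>
  A bounded check that the \<open>m\<close> members of the \<open>n\<close>-th join that are described by the words \<open>w l\<close> of length
  \<open>n\<close> over the letters below \<open>b\<close> cover \<open>K\<close>.  By distributivity, a union of intersections
  is an intersection, over all choice functions \<open>\<phi>\<close> from \<open>{..<m}\<close> to \<open>{..<n}\<close>, of unions.  So the check
  is a finite conjunction of covering statements for finite sets of balls, each of which the machine
  \<open>MX\<close> confirms by halting, and it avoids computing intersections of balls.  The matrix of words is the
  number \<open>W\<close> in base \<open>b\<close>, the choice functions are the numbers below \<open>n ^ m\<close> in base \<open>n\<close>.
\<close>

definition accepts ::
    "machine \<Rightarrow> machine \<Rightarrow> (nat \<Rightarrow> nat) \<Rightarrow> (nat \<Rightarrow> nat) \<Rightarrow> nat \<Rightarrow> nat \<Rightarrow> nat \<Rightarrow> nat \<Rightarrow> nat \<Rightarrow> nat \<Rightarrow> bool" where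
  "accepts MX MK V J b n m W t t' \<longleftrightarrow>
     (\<forall>\<Phi><n ^ m. halts_within MX (set_encode
        (verified_balls MK V t J m (\<lambda>l k. digit b (l * n + k) W) (\<lambda>l. digit n l \<Phi>))) t')"

lemma pr_pred_accepts:
  assumes "turing_machine MX" "turing_machine MK" and V: "pr V" and J: "pr J"
  shows "pr_pred (\<lambda>z. accepts MX MK V J b (pfst z) (pfst (psnd z)) (pfst (psnd (psnd z)))
           (pfst (psnd (psnd (psnd z)))) (psnd (psnd (psnd (psnd z)))))"
  unfolding accepts_def verified_balls_def
  by (intro pr_intros pr_pred_mem_pullback[OF V] pr_comp[OF J] assms)

lemma digits_exist:
  assumes "\<And>l. l < N \<Longrightarrow> d l < b" "0 < b"
  obtains D where "D < b ^ N" "\<And>l. l < N \<Longrightarrow> digit b l D = d l"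
proof -
  let ?d = "\<lambda>l. if l < N then d l else 0"
  let ?D = "\<lambda>M. \<Sum>l<M. ?d l * b ^ l"
  have d: "?d l < b" for l using assms by simp
  have "?D M < b ^ M" for M
  proof (induction M)
    case (Suc M)
    have "?D (Suc M) < Suc (?d M) * b ^ M" using Suc by simp
    also have "\<dots> \<le> b * b ^ M" using d[of M] by (intro mult_right_mono) auto
    finally show ?case by simp
  qed simp
  moreover have "digit b l (?D N) = d l" if "l < N" for l
    using digit_sum[of ?d b l N] d that by simp
  ultimately show thesis using that[of "?D N"] by blast
qed

text \<open>
  A point of \<open>K\<close> outside all the described members of the join yields a choice function: for each member a time
  at which the orbit of the point misses the corresponding ball.  The point is then left uncovered in the
  check of this choice function.
\<close>

lemma accepts_sound:
  assumes MX: "\<And>I. finite I \<Longrightarrow> halts MX (set_encode I) \<Longrightarrow> (UNIV :: 'a set) \<subseteq> (\<Union>i\<in>I. B i)"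
    and MK: "- K = (\<Union>i\<in>{i. halts MK i}. B i)"
    and V: "\<And>n t. V (prod_encode (n, t)) = 0 \<or> V (prod_encode (n, t)) = Suc (e n)"
    and e: "\<And>m. f -` B m = (\<Union>i\<in>{i. \<exists>u. e (prod_encode (m, u)) = Suc i}. B i)"
    and acc: "accepts MX MK V J b n m W t t'" and "0 < n" "0 < b"
  shows "cover_number K f ((\<lambda>d. B (J d)) ` {..<b}) n \<le> m"
proof -
  let ?w = "\<lambda>l k. digit b (l * n + k) W"
  let ?A = "\<lambda>l. {x. \<forall>k<n. (f ^^ k) x \<in> B (J (?w l k))}"
  have "K \<subseteq> \<Union>(?A ` {..<m})"
  proof (rule subsetI, rule ccontr)
    fix x assume x: "x \<in> K" "x \<notin> \<Union>(?A ` {..<m})"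
    then have "\<forall>l\<in>{..<m}. \<exists>k. k < n \<and> (f ^^ k) x \<notin> B (J (?w l k))" by blast
    from bchoice[OF this] obtain \<phi>
      where \<phi>: "\<And>l. l < m \<Longrightarrow> \<phi> l < n" "\<And>l. l < m \<Longrightarrow> (f ^^ \<phi> l) x \<notin> B (J (?w l (\<phi> l)))" by blast
    obtain \<Phi> where \<Phi>: "\<Phi> < n ^ m" "\<And>l. l < m \<Longrightarrow> digit n l \<Phi> = \<phi> l"
      using digits_exist[of m \<phi> n] \<phi>(1) \<open>0 < n\<close> by metis
    let ?I = "verified_balls MK V t J m ?w (\<lambda>l. digit n l \<Phi>)"
    have "finite ?I" by (simp add: verified_balls_def)
    moreover have "halts MX (set_encode ?I)"
      using acc \<Phi>(1) halts_iff_within unfolding accepts_def by blast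
    ultimately obtain i where i: "i \<in> ?I" "x \<in> B i" using MX[of ?I] by blast
    have "\<not> halts MK i" using MK i(2) x(1) by blast
    then obtain l where "l < m" "i \<in> pullback V t (digit n l \<Phi>) (J (?w l (digit n l \<Phi>)))"
      using i(1) halts_iff_within unfolding verified_balls_def by blast
    with pullback_sound[OF V e this(2) i(2)] \<Phi>(2) \<phi>(2) show False by simp
  qed
  moreover have "?A ` {..<m} \<subseteq> cover_join f ((\<lambda>d. B (J d)) ` {..<b}) n"
    using digit_less[OF \<open>0 < b\<close>] by (intro image_subsetI cover_joinI) auto
  ultimately have "cover_number K f ((\<lambda>d. B (J d)) ` {..<b}) n \<le> card (?A ` {..<m})"
    by (intro cover_number_le) auto
  also have "\<dots> \<le> m" using card_image_le[of "{..<m}" ?A] by simp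
  finally show ?thesis .
qed

text \<open>
  Take a subcover of minimal cardinality.  For each choice function, every point of the space lies in some
  ball that belongs to the checked family from some stage on; by compactness finitely many of these
  balls suffice, so some stage works for all points, and then for all choice functions.
\<close>

lemma accepts_complete:
  fixes B :: "nat \<Rightarrow> 'a::metric_space set"
  assumes X: "compact (UNIV :: 'a set)" and B: "\<And>i. open (B i)"
    and MX: "\<And>I. finite I \<Longrightarrow> (UNIV :: 'a set) \<subseteq> (\<Union>i\<in>I. B i) \<Longrightarrow> halts MX (set_encode I)"
    and MK: "- K = (\<Union>i\<in>{i. halts MK i}. B i)"
    and V: "\<And>n. \<forall>\<^sub>F t in sequentially. V (prod_encode (n, t)) = Suc (e n)"
    and e: "\<And>m. f -` B m = (\<Union>i\<in>{i. \<exists>u. e (prod_encode (m, u)) = Suc i}. B i)"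
    and K: "K \<subseteq> \<Union>((\<lambda>d. B (J d)) ` {..<b})" "f ` K \<subseteq> K" and "0 < n" "0 < b"
  shows "\<exists>W t t'. accepts MX MK V J b n (cover_number K f ((\<lambda>d. B (J d)) ` {..<b}) n) W t t'"
proof -
  let ?U = "(\<lambda>d. B (J d)) ` {..<b}"
  define m where "m = cover_number K f ?U n"
  have "finite ?U" by simp
  from cover_number_attained[OF this K, of n] obtain \<C>
    where C: "\<C> \<subseteq> cover_join f ?U n" "K \<subseteq> \<Union>\<C>" "finite \<C>" "card \<C> = m" unfolding m_def by blast
  then obtain A where A: "bij_betw A {0..<m} \<C>" using ex_bij_betw_nat_finite by blast
  have "\<forall>l\<in>{..<m}. \<exists>w. \<forall>k<n. w k < b \<and> (\<forall>x\<in>A l. (f ^^ k) x \<in> B (J (w k)))"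
  proof
    fix l assume "l \<in> {..<m}"
    then have "A l \<in> cover_join f ?U n" using A C(1) bij_betwE by fastforce
    then obtain U where U: "\<And>k. k < n \<Longrightarrow> U k \<in> ?U" "\<And>x. x \<in> A l \<longleftrightarrow> (\<forall>k<n. (f ^^ k) x \<in> U k)"
      by (elim cover_joinE) metis
    have "\<forall>k\<in>{..<n}. \<exists>d. d < b \<and> U k = B (J d)" using U(1) by fastforce
    from bchoice[OF this] obtain w where "\<And>k. k < n \<Longrightarrow> w k < b \<and> U k = B (J (w k))" by blast
    then show "\<exists>w. \<forall>k<n. w k < b \<and> (\<forall>x\<in>A l. (f ^^ k) x \<in> B (J (w k)))"
      using U(2) by metis
  qed
  from bchoice[OF this] obtain w where w: "\<And>l k. l < m \<Longrightarrow> k < n \<Longrightarrow> w l k < b"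
    "\<And>l k x. l < m \<Longrightarrow> k < n \<Longrightarrow> x \<in> A l \<Longrightarrow> (f ^^ k) x \<in> B (J (w l k))" by blast
  have "w (p div n) (p mod n) < b" if "p < m * n" for p
    using that \<open>0 < n\<close> by (intro w(1)) (auto simp: less_mult_imp_div_less)
  then obtain W where "\<And>p. p < m * n \<Longrightarrow> digit b p W = w (p div n) (p mod n)"
    using digits_exist[of "m * n" "\<lambda>p. w (p div n) (p mod n)" b] \<open>0 < b\<close> by metis
  moreover have "l * n + k < m * n" if "l < m" "k < n" for l k
  proof -
    have "l * n + k < Suc l * n" using that by simp
    also have "\<dots> \<le> m * n" using that by (intro mult_right_mono) auto
    finally show ?thesis .
  qed
  ultimately have W: "digit b (l * n + k) W = w l k" if "l < m" "k < n" for l k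
    using that by simp
  let ?I = "\<lambda>t \<Phi>. verified_balls MK V t J m (\<lambda>l k. digit b (l * n + k) W) (\<lambda>l. digit n l \<Phi>)"
  have "\<forall>\<^sub>F t in sequentially. UNIV \<subseteq> (\<Union>i\<in>?I t \<Phi>. B i)" for \<Phi>
  proof -
    have "\<exists>i. x \<in> B i \<and> (\<forall>\<^sub>F t in sequentially. i \<in> ?I t \<Phi>)" for x
    proof (cases "x \<in> K")
      case True
      then obtain l where l: "l < m" "x \<in> A l" using C(2) A by (force simp: bij_betw_def)
      let ?k = "digit n l \<Phi>"
      have k: "?k < n" using \<open>0 < n\<close> by (rule digit_less)
      have "(f ^^ ?k) x \<in> B (J (w l ?k))" by (rule w(2)[OF l(1) k l(2)])
      from pullback_complete[OF V e this] obtain i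
        where i: "x \<in> B i" "\<forall>\<^sub>F t in sequentially. i \<in> pullback V t ?k (J (w l ?k))" by blast
      have "\<forall>\<^sub>F t in sequentially. i \<in> ?I t \<Phi>"
        using i(2) eventually_gt_at_top[of i]
        by eventually_elim (use l(1) W[OF l(1) k] in \<open>auto simp: verified_balls_def\<close>)
      with i(1) show ?thesis by blast
    next
      case False
      then obtain i t0 where i: "x \<in> B i" "halts_within MK i t0" using MK halts_iff_within by blast
      have "\<forall>\<^sub>F t in sequentially. i \<in> ?I t \<Phi>"
        using eventually_ge_at_top[of t0] eventually_gt_at_top[of i]
        by eventually_elim (use halts_within_mono[OF i(2)] in \<open>auto simp: verified_balls_def\<close>)
      with i(1) show ?thesis by blast
    qed
    then obtain \<iota> where \<iota>: "\<And>x. x \<in> B (\<iota> x)" "\<And>x. \<forall>\<^sub>F t in sequentially. \<iota> x \<in> ?I t \<Phi>" by metis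
    obtain D where D: "finite D" "UNIV \<subseteq> (\<Union>x\<in>D. B (\<iota> x))"
      by (rule compactE_image[OF X, of UNIV "\<lambda>x. B (\<iota> x)"]) (use B \<iota>(1) in auto)
    have "\<forall>\<^sub>F t in sequentially. \<forall>x\<in>D. \<iota> x \<in> ?I t \<Phi>"
      using \<iota>(2) D(1) by (simp add: eventually_ball_finite)
    then show ?thesis by eventually_elim (use D(2) in blast)
  qed
  then have "\<forall>\<^sub>F t in sequentially. \<forall>\<Phi>\<in>{..<n ^ m}. UNIV \<subseteq> (\<Union>i\<in>?I t \<Phi>. B i)"
    by (intro eventually_ball_finite) auto
  then obtain t where t: "\<And>\<Phi>. \<Phi> < n ^ m \<Longrightarrow> UNIV \<subseteq> (\<Union>i\<in>?I t \<Phi>. B i)"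
    by (auto dest!: eventually_happens)
  have "\<forall>\<^sub>F t' in sequentially. halts_within MX (set_encode (?I t \<Phi>)) t'" if "\<Phi> \<in> {..<n ^ m}" for \<Phi>
  proof -
    have "finite (?I t \<Phi>)" by (simp add: verified_balls_def)
    then have "halts MX (set_encode (?I t \<Phi>))" using MX t that by blast
    then obtain t0 where "halts_within MX (set_encode (?I t \<Phi>)) t0" using halts_iff_within by blast
    then show ?thesis unfolding eventually_sequentially using halts_within_mono by blast
  qed
  then have "\<forall>\<^sub>F t' in sequentially. \<forall>\<Phi>\<in>{..<n ^ m}. halts_within MX (set_encode (?I t \<Phi>)) t'"
    by (intro eventually_ball_finite) auto
  then obtain t' where "\<And>\<Phi>. \<Phi> < n ^ m \<Longrightarrow> halts_within MX (set_encode (?I t \<Phi>)) t'"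
    by (auto dest!: eventually_happens)
  then have "accepts MX MK V J b n m W t t'" by (simp add: accepts_def)
  then show ?thesis unfolding m_def by blast
qed

section \<open>Upper computability of the entropy\<close>

text \<open>
  Upper bounds \<open>p / d\<close> of \<open>log 2 m / n\<close> are recognised in integer arithmetic.
\<close>

lemma power_le_iff_log_le:
  assumes "1 \<le> m" "1 \<le> d" "1 \<le> n"
  shows "m ^ d \<le> (2::nat) ^ (p * n) \<longleftrightarrow> log 2 m / n \<le> real p / real d"
proof -
  have "m ^ d \<le> 2 ^ (p * n) \<longleftrightarrow> real m ^ d \<le> 2 ^ (p * n)"
    by (metis of_nat_le_iff of_nat_numeral of_nat_power)
  also have "\<dots> \<longleftrightarrow> log 2 (real m ^ d) \<le> log 2 (2 ^ (p * n))"
    using assms by (subst log_le_cancel_iff) auto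
  also have "\<dots> \<longleftrightarrow> d * log 2 m \<le> p * n"
    using assms by (simp add: log_nat_power)
  also have "\<dots> \<longleftrightarrow> log 2 m / n \<le> real p / real d"
    using assms by (simp add: field_simps)
  finally show ?thesis .
qed

text \<open>
  Non-negative integers are coded by even numbers.
\<close>

lemma nat_to_rat_surj_quotient:
  assumes "1 \<le> d"
  shows "real_of_rat (nat_to_rat_surj (prod_encode (2 * p, 2 * d))) = real p / real d"
proof -
  have "int_decode (2 * k) = int k" for k
    using int_encode_inverse[of "int k"] by (simp add: int_encode_def sum_encode_def)
  then show ?thesis using assms by (simp add: nat_to_rat_surj_def of_rat_rat)
qed

text \<open>
  One radius serves for all centres, since the centres are dense.
\<close>

lemma small_ball_cover:
  fixes s :: "nat \<Rightarrow> 'a::metric_space"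
  assumes X: "compact (UNIV :: 'a set)" and s: "closure (range s) = UNIV"
    and balls: "\<And>i q. 0 < q \<Longrightarrow> \<exists>n. c n = i \<and> r n = q" and "0 < \<beta>"
  obtains I where "finite I" "UNIV \<subseteq> (\<Union>i\<in>I. ideal_ball s c r i)"
    "\<And>i x y. i \<in> I \<Longrightarrow> x \<in> ideal_ball s c r i \<Longrightarrow> y \<in> ideal_ball s c r i \<Longrightarrow> dist x y \<le> \<beta>"
proof -
  obtain q where q: "0 < real_of_rat q" "real_of_rat q < \<beta> / 2"
    using of_rat_dense[of 0 "\<beta> / 2"] \<open>0 < \<beta>\<close> by auto
  then have "0 < q" by simp
  with balls have "\<forall>i. \<exists>n. c n = i \<and> r n = q" by blast
  then obtain N where N: "\<And>i. c (N i) = i" "\<And>i. r (N i) = q" by metis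
  then have ball: "ideal_ball s c r (N i) = ball (s i) (real_of_rat q)" for i
    by (simp add: ideal_ball_def)
  have "UNIV \<subseteq> (\<Union>i\<in>UNIV. ideal_ball s c r (N i))"
  proof
    fix x
    have "x \<in> closure (range s)" using s by simp
    then obtain i where "dist (s i) x < real_of_rat q"
      using q(1) unfolding closure_approachable by blast
    then show "x \<in> (\<Union>i\<in>UNIV. ideal_ball s c r (N i))" by (auto simp: ball)
  qed
  then obtain D where D: "finite D" "UNIV \<subseteq> (\<Union>i\<in>D. ideal_ball s c r (N i))"
    by (rule compactE_image[OF X, rotated]) (auto simp: ball)
  show thesis
  proof (rule that[of "N ` D"])
    fix i x y assume "i \<in> N ` D" "x \<in> ideal_ball s c r i" "y \<in> ideal_ball s c r i"
    then obtain j where "dist (s j) x < real_of_rat q" "dist (s j) y < real_of_rat q"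
      by (auto simp: ball)
    then show "dist x y \<le> \<beta>" using dist_triangle3[of x y "s j"] q(2) by simp
  qed (use D in auto)
qed

theorem corollary20:
  fixes s :: "nat \<Rightarrow> 'a::metric_space"
    and c :: "nat \<Rightarrow> nat" and r :: "nat \<Rightarrow> rat"
    and K :: "'a set" and f :: "'a \<Rightarrow> 'a"
  assumes "computable_metric_space s"
    and "ideal_ball_enumeration c r"
    and "recursively_compact (ideal_ball s c r)"
    and "computable_dynamical_system (ideal_ball s c r) K f"
    and "expansive f"
  shows "\<exists>h. topological_entropy K f = ereal h \<and> Pi1_computable h"
proof -
  let ?B = "ideal_ball s c r"
  have X: "compact (UNIV :: 'a set)" using assms(3) by (simp add: recursively_compact_def)
  \<comment> \<open>the algorithms that are simulated: for coverings of the space, for the complement of \<open>K\<close>, and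
    for preimages of balls\<close>
  obtain MX where MX: "turing_machine MX"
    "\<And>I. finite I \<Longrightarrow> halts MX (set_encode I) \<longleftrightarrow> UNIV \<subseteq> (\<Union>n\<in>I. ?B n)"
    using assms(3) unfolding recursively_compact_def by blast
  have dyn: "dynamical_system K f"
    using assms(4) by (simp add: computable_dynamical_system_def)
  then have K: "f ` K \<subseteq> K" "K \<noteq> {}" by (auto simp: dynamical_system_def)
  obtain MK where MK: "turing_machine MK" "- K = (\<Union>n\<in>{n. halts MK n}. ?B n)"
    using assms(4) unfolding computable_dynamical_system_def effective_closed_def by blast
  obtain e where "computable_fun e"
    and e: "\<And>m. f -` ?B m = (\<Union>i\<in>{i. \<exists>t. e (prod_encode (m, t)) = Suc i}. ?B i)"
    using assms(4) unfolding computable_dynamical_system_def computable_map_def by blast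
  from computable_fun_approximation[OF this(1)] obtain V where V: "pr V"
    "\<And>n t. V (prod_encode (n, t)) = 0 \<or> V (prod_encode (n, t)) = Suc (e n)"
    "\<And>n. \<forall>\<^sub>F t in sequentially. V (prod_encode (n, t)) = Suc (e n)"
    unfolding eventually_sequentially by blast
  obtain \<alpha> where \<alpha>: "0 < \<alpha>" "\<And>x y. x \<noteq> y \<Longrightarrow> \<exists>n. \<alpha> \<le> dist ((f ^^ n) x) ((f ^^ n) y)"
    using assms(5) unfolding expansive_def by blast
  have dense: "closure (range s) = UNIV"
    using assms(1) by (simp add: computable_metric_space_def)
  have balls: "\<exists>n. c n = i \<and> r n = q" if "0 < q" for i q
    using assms(2) that unfolding ideal_ball_enumeration_def by blast
  \<comment> \<open>a generating cover by ideal balls; it is fixed once and for all, so nothing about it has to be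
    computed beyond its finite table of indices\<close>
  have "0 < \<alpha> / 2" using \<alpha>(1) by simp
  from small_ball_cover[OF X dense balls this] obtain I where I: "finite I" "UNIV \<subseteq> (\<Union>i\<in>I. ?B i)"
    "\<And>i x y. i \<in> I \<Longrightarrow> x \<in> ?B i \<Longrightarrow> y \<in> ?B i \<Longrightarrow> dist x y \<le> \<alpha> / 2"
    by metis
  define b where "b = card I"
  obtain j where "bij_betw j {0..<b} I" using ex_bij_betw_nat_finite[OF I(1)] unfolding b_def by blast
  then have j: "j ` {..<b} = I" by (simp add: bij_betw_def lessThan_atLeast0)
  obtain J where J: "pr J" "\<And>d. d \<in> {..<b} \<Longrightarrow> J d = j d"
    using pr_finite_table[of "{..<b}" j] by blast
  define \<U> where "\<U> = (\<lambda>d. ?B (J d)) ` {..<b}"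
  have U_eq: "\<U> = ?B ` I" unfolding \<U>_def j[symmetric] image_image using J(2) by simp
  have "0 < b" using I(1,2) K(2) unfolding b_def by (auto simp: card_gt_0_iff)
  have finU: "finite \<U>" by (simp add: \<U>_def)
  have KU: "K \<subseteq> \<Union>\<U>" using I(2) by (auto simp: U_eq)
  have cov: "open_cover K \<U>" using KU by (auto simp: open_cover_def U_eq ideal_ball_def)
  have entropy: "topological_entropy K f = ereal (cover_entropy K f \<U>)"
    by (rule entropy_of_generating_cover[OF X dyn \<alpha>(2) finU cov, where \<beta> = "\<alpha> / 2"])
      (use I(3) \<alpha>(1) in \<open>auto simp: U_eq\<close>)
  define h where "h = cover_entropy K f \<U>"
  let ?N = "cover_number K f \<U>"
  have N_pos: "1 \<le> ?N n" for n by (rule cover_number_pos[OF finU KU K])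
  \<comment> \<open>the value for inputs that certify nothing; any rational upper bound of the entropy will do\<close>
  define C where "C = nat \<lceil>h\<rceil>"
  have C: "h \<le> real C" unfolding C_def by (rule real_nat_ceiling_ge)
  let ?acc = "accepts MX MK V J b"
  \<comment> \<open>an input that certifies the upper bound \<open>p / d\<close>\<close>
  define ok where "ok = (\<lambda>n m W t t' p d. 1 \<le> n \<and> 1 \<le> d \<and> m ^ d \<le> 2 ^ (p * n) \<and> ?acc n m W t t')"
  define g where "g = (\<lambda>z.
    let n = pfst (pfst z); m = pfst (psnd (pfst z)); W = pfst (psnd (psnd (pfst z)));
      t = pfst (psnd (psnd (psnd (pfst z)))); t' = psnd (psnd (psnd (psnd (pfst z))));
      p = pfst (psnd z); d = psnd (psnd z)
    in if ok n m W t t' p d then prod_encode (2 * p, 2 * d) else prod_encode (2 * C, 2 * 1))"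
  have "pr g"
  proof -
    have "pr_pred (\<lambda>z. ?acc (pfst (pfst z)) (pfst (psnd (pfst z))) (pfst (psnd (psnd (pfst z))))
           (pfst (psnd (psnd (psnd (pfst z))))) (psnd (psnd (psnd (psnd (pfst z))))))"
      using pr_comp[OF pr_pred_accepts[OF MX(1) MK(1) V(1) J(1), of b, unfolded pr_pred_def] pr_pfst[OF pr_id]]
      unfolding pr_pred_def .
    then show ?thesis unfolding g_def ok_def Let_def by (intro pr_intros)
  qed
  let ?q = "\<lambda>z. real_of_rat (nat_to_rat_surj (g z))"
  \<comment> \<open>soundness of certificates: every term of the sequence is an upper bound of the entropy\<close>
  have lower: "h \<le> ?q z" for z
  proof -
    have "h \<le> real p / real d" if "ok n m W t t' p d" for n m W t t' p d
    proof -
      have ok: "1 \<le> n" "1 \<le> d" "m ^ d \<le> 2 ^ (p * n)" "?acc n m W t t'" using that by (auto simp: ok_def)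
      have "?N n \<le> m"
        unfolding \<U>_def by (rule accepts_sound[OF _ MK(2) V(2) e ok(4)]) (use MX(2) ok(1) \<open>0 < b\<close> in auto)
      then have "1 \<le> m" using N_pos[of n] by simp
      have "h \<le> log 2 (?N n) / n" unfolding h_def by (rule cover_entropy_lower[OF finU KU K ok(1)])
      also have "\<dots> \<le> log 2 m / n"
        using \<open>?N n \<le> m\<close> N_pos[of n] by (intro divide_right_mono log_mono) auto
      also have "\<dots> \<le> real p / real d" using power_le_iff_log_le[OF \<open>1 \<le> m\<close> ok(2,1)] ok(3) by blast
      finally show ?thesis .
    qed
    moreover have "1 \<le> d" if "ok n m W t t' p d" for n m W t t' p d using that by (simp add: ok_def)
    moreover have "real_of_rat (nat_to_rat_surj (prod_encode (2 * C, 2 * 1))) = real C"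
      using nat_to_rat_surj_quotient[of 1 C] by simp
    ultimately show ?thesis
      using C by (auto simp: g_def Let_def nat_to_rat_surj_quotient simp del: mult_1_right)
  qed
  \<comment> \<open>completeness: an optimal cover for a suitable \<open>n\<close> has a certificate, with a fraction \<open>p / d\<close>
    in the remaining gap\<close>
  have approx: "\<exists>z. ?q z < h + \<epsilon>" if "0 < \<epsilon>" for \<epsilon>
  proof -
    have "\<exists>n\<in>{1..}. log 2 (?N n) / n < h + \<epsilon>"
    proof (rule ccontr)
      assume "\<not> ?thesis"
      then have "h + \<epsilon> \<le> (INF n\<in>{1..}. log 2 (?N n) / n)"
        by (intro cINF_greatest) (auto simp: not_less)
      then have "h + \<epsilon> \<le> h" by (simp add: h_def cover_entropy_def)
      with that show False by simp
    qed
    then obtain n where n: "1 \<le> n" "log 2 (?N n) / n < h + \<epsilon>" by auto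
    obtain x where x: "x \<in> \<rat>" "log 2 (?N n) / n < x" "x < h + \<epsilon>" using Rats_dense_in_real[OF n(2)] by blast
    have "0 \<le> log 2 (?N n) / n" using N_pos[of n] by simp
    then have "\<bar>x\<bar> = x" using x(2) by simp
    with x(1) obtain p d where pd: "d \<noteq> 0" "x = real p / real d" by (metis Rats_abs_nat_div_natE)
    have "\<exists>W t t'. ?acc n (?N n) W t t'"
      unfolding \<U>_def
      by (rule accepts_complete[OF X _ _ MK(2) V(3) e])
        (use MX(2) KU K n(1) \<open>0 < b\<close> in \<open>auto simp: \<U>_def ideal_ball_def\<close>)
    then obtain W t t' where "?acc n (?N n) W t t'" by blast
    moreover have "?N n ^ d \<le> 2 ^ (p * n)"
      using power_le_iff_log_le[OF N_pos[of n] _ n(1), of d p] x(2) pd by simp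
    ultimately have "ok n (?N n) W t t' p d" using n(1) pd by (simp add: ok_def)
    then have "?q (prod_encode (prod_encode (n, prod_encode (?N n, prod_encode (W, prod_encode (t, t')))),
        prod_encode (p, d))) = x"
      using pd by (simp add: g_def nat_to_rat_surj_quotient)
    with x(3) show ?thesis by metis
  qed
  have bdd: "bdd_below (range ?q)" using lower by (intro bdd_belowI2[of _ h])
  have "h = (INF z. ?q z)"
  proof (rule antisym)
    show "h \<le> (INF z. ?q z)" using lower by (intro cINF_greatest) auto
    show "(INF z. ?q z) \<le> h"
    proof (rule field_le_epsilon)
      fix \<epsilon> :: real assume "0 < \<epsilon>"
      from approx[OF this] obtain z where "?q z < h + \<epsilon>" by blast
      with cINF_lower[OF bdd, of z] show "(INF z. ?q z) \<le> h + \<epsilon>" by simp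
    qed
  qed
  moreover have "computable_rat_seq (\<lambda>z. nat_to_rat_surj (g z))"
    unfolding computable_rat_seq_def using pr_computable[OF \<open>pr g\<close>] by blast
  ultimately have "Pi1_computable h"
    unfolding Pi1_computable_def using bdd by (intro exI[of _ "\<lambda>z. nat_to_rat_surj (g z)"]) simp
  with entropy show ?thesis unfolding h_def by blast
qed

end
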